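(* Let $A$ be an invertible $d\times d$ integer matrix with (complex) eigenvalues $\lambda_1,\dots,\lambda_d$ counted with multiplicity and ordered so that $0<|\lambda_1|\le|\lambda_2|\le\dots\le|\lambda_d|$, and put $l_j=\log|\lambda_j|$. Let $T\colon\mathbb{T}^d\to\mathbb{T}^d$, $T(x)=Ax\bmod 1$, let $(z_n)_{n\in\mathbb{N}}$ be any sequence of points in $\mathbb{T}^d$, and for $\tau\ge 0$ let $$W_\tau=\{x\in\mathbb{T}^d : T^n(x)\in B(z_n,e^{-n\tau})\text{ for infinitely many } n\in\mathbb{N}\}.$$ Then for any $\tau\ge 0$, $$\dim_{\mathrm H}W_\tau\le\min_k\left\{\frac{k\,l_k+\sum_{j>k}l_j}{\tau+l_k}\right\},$$ where the minimum is over those $k\in\{1,\dots,d\}$ for which $\tau+l_k>0$.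
   Context: $\mathbb{T}^d=\mathbb{R}^d/\mathbb{Z}^d$ with the metric induced by the Euclidean metric; $B(z,r)$ is the open ball with centre $z$ and radius $r$. $\dim_{\mathrm H}$ denotes Hausdorff dimension, with the convention $\dim_{\mathrm H}\emptyset=0$. A minimum over an empty set of indices (which can occur only if $\tau=0$ and all $l_k=0$) is read as $+\infty$. *)

theory Defs
  imports "HOL-Analysis.Analysis" "HOL-Computational_Algebra.Polynomial"
begin

section \<open>The torus and its metric\<close>

definition int_lattice :: "(real ^ 'n) set" where
  "int_lattice = {v. \<forall>i. v $ i \<in> \<int>}"

lemma int_lattice_zero [simp]: "0 \<in> int_lattice"
  by (simp add: int_lattice_def)

lemma int_lattice_nonempty: "int_lattice \<noteq> {}"
  using int_lattice_zero by blast

lemma int_lattice_add: "x \<in> int_lattice \<Longrightarrow> y \<in> int_lattice \<Longrightarrow> x + y \<in> int_lattice"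
  by (simp add: int_lattice_def)

lemma int_lattice_diff: "x \<in> int_lattice \<Longrightarrow> y \<in> int_lattice \<Longrightarrow> x - y \<in> int_lattice"
  by (simp add: int_lattice_def)

lemma int_lattice_uminus: "x \<in> int_lattice \<Longrightarrow> - x \<in> int_lattice"
  by (simp add: int_lattice_def)

lemma int_lattice_matrix_mult:
  fixes A :: "int ^ 'n ^ 'm"
  shows "x \<in> int_lattice \<Longrightarrow> map_matrix real_of_int A *v x \<in> int_lattice"
  by (auto simp: int_lattice_def matrix_vector_mult_def intro!: Ints_sum Ints_mult)

lemma closed_int_lattice: "closed (int_lattice :: (real ^ 'n) set)"
proof -
  have "(int_lattice :: (real ^ 'n) set) = (\<Inter>i. (\<lambda>v :: real ^ 'n. v $ i) -` \<int>)"
    by (auto simp: int_lattice_def)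
  moreover have "closed ((\<lambda>v :: real ^ 'n. v $ i) -` \<int>)" for i
    by (intro continuous_closed_vimage closed_Ints) simp
  ultimately show ?thesis
    by (metis (no_types, lifting) closed_INT)
qed

definition torus_rel :: "real ^ 'n \<Rightarrow> real ^ 'n \<Rightarrow> bool" where
  "torus_rel x y \<longleftrightarrow> x - y \<in> int_lattice"

lemma equivp_torus_rel: "equivp torus_rel"
proof (rule equivpI)
  show "reflp torus_rel"
    by (simp add: reflp_def torus_rel_def)
  show "symp torus_rel"
    by (metis (mono_tags) int_lattice_uminus minus_diff_eq sympI torus_rel_def)
  show "transp torus_rel"
    using int_lattice_add by (fastforce simp: transp_def torus_rel_def)
qed

quotient_type (overloaded) 'n torus = "real ^ ('n::finite)" / torus_rel
  by (rule equivp_torus_rel)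

lemma infdist_int_lattice:
  "(INF k\<in>int_lattice. norm (x - y - k)) = infdist (x - y) int_lattice"
  by (simp add: infdist_def dist_norm int_lattice_nonempty)

lemma infdist_int_lattice_cong_le:
  assumes "u - v \<in> int_lattice"
  shows "infdist u int_lattice \<le> infdist v int_lattice"
proof -
  have "infdist u int_lattice \<le> dist v k" if "k \<in> int_lattice" for k
  proof -
    have "k + (u - v) \<in> int_lattice"
      using assms that int_lattice_add by blast
    moreover have "dist u (k + (u - v)) = dist v k"
      by (simp add: dist_norm)
    ultimately show ?thesis
      by (metis infdist_le)
  qed
  then show ?thesis
    unfolding infdist_notempty[OF int_lattice_nonempty, of v] by (intro cINF_greatest int_lattice_nonempty) auto
qed

lemma infdist_int_lattice_cong:
  assumes "u - v \<in> int_lattice"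
  shows "infdist u int_lattice = infdist v int_lattice"
  using assms infdist_int_lattice_cong_le int_lattice_uminus
  by (metis antisym minus_diff_eq)

lemma infdist_int_lattice_add:
  "infdist (u + v) int_lattice \<le> infdist u int_lattice + infdist v int_lattice"
proof -
  obtain k where k: "k \<in> int_lattice" "infdist v int_lattice = dist v k"
    using infdist_attains_inf[OF closed_int_lattice int_lattice_nonempty] by blast
  have "infdist (u + v) int_lattice = infdist (u + v - k) int_lattice"
    by (rule infdist_int_lattice_cong) (simp add: k)
  also have "\<dots> \<le> infdist u int_lattice + dist (u + v - k) u"
    by (rule infdist_triangle)
  also have "dist (u + v - k) u = dist v k"
    by (simp add: dist_norm)
  finally show ?thesis
    by (simp add: k)
qed

instantiation torus :: (finite) metric_space
begin

lift_definition dist_torus :: "'a torus \<Rightarrow> 'a torus \<Rightarrow> real"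
  is "\<lambda>x y. INF k\<in>int_lattice. norm (x - y - k)"
proof -
  fix x x' y y' :: "real ^ 'a"
  assume "torus_rel x x'" "torus_rel y y'"
  then have "(x - y) - (x' - y') \<in> int_lattice"
    using int_lattice_diff[of "x - x'" "y - y'"] by (simp add: torus_rel_def algebra_simps)
  then show "(INF k\<in>int_lattice. norm (x - y - k)) = (INF k\<in>int_lattice. norm (x' - y' - k))"
    unfolding infdist_int_lattice by (rule infdist_int_lattice_cong)
qed

definition uniformity_torus :: "('a torus \<times> 'a torus) filter" where
  "uniformity_torus = (INF e\<in>{0<..}. principal {(x, y). dist x y < e})"

definition open_torus :: "'a torus set \<Rightarrow> bool" where
  "open_torus S = (\<forall>x\<in>S. \<forall>\<^sub>F (x', y) in uniformity. x' = x \<longrightarrow> y \<in> S)"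

instance
proof
  fix x y z :: "'a torus"
  show "dist x y = 0 \<longleftrightarrow> x = y"
  proof transfer
    fix x y :: "real ^ 'a"
    show "(INF k\<in>int_lattice. norm (x - y - k)) = 0 \<longleftrightarrow> torus_rel x y"
      unfolding infdist_int_lattice torus_rel_def
      using in_closed_iff_infdist_zero[OF closed_int_lattice int_lattice_nonempty] by blast
  qed
  show "dist x y \<le> dist x z + dist y z"
  proof transfer
    fix x y z :: "real ^ 'a"
    have *: "infdist (z - y) int_lattice \<le> infdist (y - z) int_lattice"
    proof -
      have ne: "int_lattice \<noteq> {}"
        using int_lattice_zero by blast
      obtain k where k: "k \<in> int_lattice" "infdist (y - z) int_lattice = dist (y - z) k"
        using infdist_attains_inf[OF closed_int_lattice int_lattice_nonempty] by blast
      have "dist (z - y) (- k) = dist (y - z) k"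
        by (metis dist_minus minus_diff_eq)
      then show ?thesis
        using infdist_le[OF int_lattice_uminus[OF k(1)], of "z - y"] k(2) by simp
    qed
    have "infdist (x - y) int_lattice \<le> infdist (x - z) int_lattice + infdist (z - y) int_lattice"
      using infdist_int_lattice_add[of "x - z" "z - y"] by simp
    then show "(INF k\<in>int_lattice. norm (x - y - k)) \<le>
        (INF k\<in>int_lattice. norm (x - z - k)) + (INF k\<in>int_lattice. norm (y - z - k))"
      unfolding infdist_int_lattice using * by simp
  qed
qed (simp_all add: uniformity_torus_def open_torus_def)

end

lift_definition torus_map :: "int ^ 'n ^ 'n \<Rightarrow> 'n torus \<Rightarrow> 'n torus"
  is "\<lambda>A x. map_matrix real_of_int A *v x"
  unfolding torus_rel_def
  by (metis int_lattice_matrix_mult matrix_vector_mult_diff_distrib)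

definition shrinking_target_set ::
    "int ^ 'n ^ 'n \<Rightarrow> (nat \<Rightarrow> 'n torus) \<Rightarrow> real \<Rightarrow> 'n torus set" where
  "shrinking_target_set A z \<tau> =
     {x. \<exists>\<^sub>\<infinity>n. (torus_map A ^^ n) x \<in> ball (z n) (exp (- (real n * \<tau>)))}"

section \<open>Characteristic polynomial\<close>

definition charpoly :: "'a::comm_ring_1 ^ 'n ^ 'n \<Rightarrow> 'a poly" where
  "charpoly M = det (mat [:0, 1:] - map_matrix (\<lambda>a. [:a:]) M)"

section \<open>Hausdorff dimension\<close>

text \<open>The gauge \<open>(diam U)\<^sup>s\<close>, with \<open>(diam U)\<^sup>0 = 1\<close> for nonempty \<open>U\<close>
  (note that \<^term>\<open>0 powr 0 = (0::real)\<close>) and value \<open>0\<close> on the empty set.\<close>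

definition hausdorff_gauge :: "real \<Rightarrow> 'a::metric_space set \<Rightarrow> ennreal" where
  "hausdorff_gauge s U =
     (if U = {} then 0 else if s = 0 then 1 else ennreal (diameter U powr s))"

text \<open>Boundedness is required because \<^const>\<open>diameter\<close> is only meaningful on bounded sets.
  Finite covers are included: pad with empty sets.\<close>

definition hausdorff_premeasure :: "real \<Rightarrow> real \<Rightarrow> 'a::metric_space set \<Rightarrow> ennreal" where
  "hausdorff_premeasure s \<delta> S =
     (INF U\<in>{U :: nat \<Rightarrow> 'a set. S \<subseteq> (\<Union>i. U i) \<and> (\<forall>i. bounded (U i) \<and> diameter (U i) \<le> \<delta>)}.
        \<Sum>i. hausdorff_gauge s (U i))"

definition hausdorff_measure :: "real \<Rightarrow> 'a::metric_space set \<Rightarrow> ennreal" where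
  "hausdorff_measure s S = (SUP \<delta>\<in>{0<..}. hausdorff_premeasure s \<delta> S)"

definition hausdorff_dim :: "'a::metric_space set \<Rightarrow> ereal" where
  "hausdorff_dim S = (INF s\<in>{s. 0 \<le> s \<and> hausdorff_measure s S = 0}. ereal s)"

lemma hausdorff_dim_empty: "hausdorff_dim ({} :: 'a::metric_space set) = 0"
proof -
  have "hausdorff_premeasure 0 \<delta> ({} :: 'a set) = 0" if "\<delta> > 0" for \<delta>
  proof -
    have "hausdorff_premeasure 0 \<delta> ({} :: 'a set) \<le> (\<Sum>i. hausdorff_gauge 0 ((\<lambda>i::nat. {} :: 'a set) i))"
      unfolding hausdorff_premeasure_def using that by (intro INF_lower) auto
    then show ?thesis
      by (simp add: hausdorff_gauge_def)
  qed
  then have "hausdorff_measure 0 ({} :: 'a set) = 0"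
    unfolding hausdorff_measure_def by (simp add: SUP_eq_iff)
  then show ?thesis
    unfolding hausdorff_dim_def
    by (intro antisym INF_lower2[of 0] INF_greatest) auto
qed

end

theory Submission
  imports Defs "Jordan_Normal_Form.Schur_Decomposition"
begin

text \<open>
  Fix \<open>k\<close> with \<open>\<tau> + l k > 0\<close>, put \<open>r = exp (- n \<tau>)\<close> and let \<open>d\<close> be the dimension. The target set is the
  limit superior of the preimages of the balls \<open>B(z\<^sub>n, r)\<close> under the \<open>n\<close>-th iterate of the toral
  endomorphism. Each preimage is a union of ellipsoids with semiaxes of length about \<open>r exp (- n l j)\<close>, and
  it is covered by cubes of side \<open>\<rho> = r exp (- n l k)\<close>, the size of the \<open>k\<close>-th semiaxis. About
  \<open>exp (n S)\<close> cubes suffice, where \<open>S = k l k + \<Sum>\<^sub>j\<^sub>>\<^sub>k l j\<close>; hence the sum over all \<open>n\<close> of the \<open>s\<close>-th powers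
  of the diameters converges as soon as \<open>s (\<tau> + l k) > S\<close>, and then the \<open>s\<close>-dimensional Hausdorff measure
  of the limit superior vanishes (\<open>hausdorff_measure_limsup_eq_0\<close>).

  The number of cubes is bounded by volume. A grid cube
  that meets the preimage is mapped by \<open>A\<^sup>n\<close> into a lattice translate of the set \<open>K = B(0, r) + A\<^sup>n Q\<close>, where
  \<open>Q\<close> is a cube of side about \<open>\<rho>\<close> centred at the origin. As the toral endomorphism preserves volume, the
  number of cubes is at most a constant times \<open>vol K / \<rho>\<^sup>d\<close>. This is \<open>card_meeting_cubes_le\<close>, proved by
  packing images of cubes into a large box.

  To bound \<open>vol K\<close>, \<open>adapted_coordinates\<close> provides \<open>d\<close> independent real linear forms, the \<open>j\<close>-th of which is at
  most \<open>C exp (n (l j + \<epsilon>)) \<bar>x\<bar>\<close> at \<open>A\<^sup>n x\<close>. They are real or imaginary parts of the rows that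
  triangularize \<open>A\<close> over the complex numbers. In these coordinates \<open>K\<close> lies in a box whose \<open>j\<close>-th side is
  about \<open>r exp (n \<epsilon>) max 1 (exp (n (l j - l k)))\<close>, so \<open>vol K / \<rho>\<^sup>d\<close> is about \<open>exp (n (S + d \<epsilon>))\<close>
  (\<open>meeting_cubes_growth\<close>). Letting \<open>\<epsilon>\<close> tend to \<open>0\<close> gives the bound for this \<open>k\<close>.
\<close>

text \<open>Below, \<open>$\<close>, \<open>\<bullet>\<close>, \<open>mat\<close> and \<open>det\<close> refer to vectors and matrices indexed by a finite type; the matrices
  with numeric indices occur only in the triangularization and are written with qualified names.\<close>

no_notation vec_index (infixl "$" 100)
no_notation scalar_prod (infix "\<bullet>" 70)
hide_const (open) Matrix.mat Matrix.row Matrix.col Determinant.det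

section \<open>Volumes of linear images and packings\<close>

text \<open>The uniqueness argument for Haar measure, applied to the translation-invariant measure
  \<open>S \<mapsto> vol (f ` S)\<close>: the double integral of \<open>1\<^sub>A (g x) * 1\<^sub>B (g x + y)\<close> is the left-hand side when
  integrated over \<open>y\<close> first; moving \<open>x\<close> by \<open>- f y\<close> turns the integrand into
  \<open>1\<^sub>A (g x - y) * 1\<^sub>B (g x)\<close>, whose integral is the right-hand side.\<close>

lemma emeasure_linear_image_proportional:
  fixes f g :: "'a::euclidean_space \<Rightarrow> 'a"
  assumes lin: "linear f" "linear g" and fg: "\<And>x. f (g x) = x" "\<And>x. g (f x) = x"
    and AB [measurable]: "A \<in> sets borel" "B \<in> sets borel"
  shows "emeasure lborel (f ` A) * emeasure lborel B = emeasure lborel (f ` B) * emeasure lborel A"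
proof -
  have [measurable]: "g \<in> borel_measurable borel" "f \<in> borel_measurable borel"
    using lin by (auto intro!: borel_measurable_continuous_onI linear_continuous_on simp: linear_linear)
  have im: "f ` S = g -` S" for S
    using fg by (auto simp: image_iff) metis
  have em: "emeasure lborel (f ` S) = (\<integral>\<^sup>+x. indicator S (g x) \<partial>lborel)" if [measurable]: "S \<in> sets borel" for S
  proof -
    have "g -` S \<in> sets lborel"
      using measurable_sets[of g borel borel S] by simp
    then have "emeasure lborel (g -` S) = (\<integral>\<^sup>+x. indicator (g -` S) x \<partial>lborel)"
      by simp
    then show ?thesis unfolding im by (simp add: indicator_vimage comp_def)
  qed
  have plus: "(\<integral>\<^sup>+x. h (c + x) \<partial>lborel) = (\<integral>\<^sup>+x. h x \<partial>lborel)"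
    if [measurable]: "h \<in> borel_measurable borel" for h :: "'a \<Rightarrow> ennreal" and c
    using nn_integral_distr[of "(+) c" lborel borel h] by (simp add: lborel_distr_plus)
  have minus: "(\<integral>\<^sup>+x. h (- x) \<partial>lborel) = (\<integral>\<^sup>+x. h x \<partial>lborel)"
    if [measurable]: "h \<in> borel_measurable borel" for h :: "'a \<Rightarrow> ennreal"
  proof -
    have "(\<lambda>x :: 'a. 0 + (\<Sum>j\<in>Basis. (- 1 * (x \<bullet> j)) *\<^sub>R j)) = uminus"
      by (simp add: fun_eq_iff sum_negf euclidean_representation)
    then have "(lborel :: 'a measure) = density (distr lborel borel uminus) (\<lambda>_. 1)"
      using lborel_affine_euclidean[where c = "\<lambda>_ :: 'a. - 1" and t = 0] by simp
    then have "distr lborel borel uminus = (lborel :: 'a measure)"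
      by (metis density_1)
    then show ?thesis
      using nn_integral_distr[of uminus lborel borel h] by simp
  qed
  have "emeasure lborel (f ` A) * emeasure lborel B
      = (\<integral>\<^sup>+x. indicator A (g x) * emeasure lborel B \<partial>lborel)"
    by (simp add: em nn_integral_multc)
  also have "\<dots> = (\<integral>\<^sup>+x. (\<integral>\<^sup>+y. indicator A (g x) * indicator B (g x + y) \<partial>lborel) \<partial>lborel)"
    by (intro nn_integral_cong) (simp add: nn_integral_cmult plus)
  also have "\<dots> = (\<integral>\<^sup>+y. (\<integral>\<^sup>+x. indicator A (g x) * indicator B (g x + y) \<partial>lborel) \<partial>lborel)"
    by (rule lborel_pair.Fubini'[symmetric]) measurable
  also have "\<dots> = (\<integral>\<^sup>+y. (\<integral>\<^sup>+x. indicator A (g x - y) * indicator B (g x) \<partial>lborel) \<partial>lborel)"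
  proof (rule nn_integral_cong)
    fix y
    have "(\<integral>\<^sup>+x. indicator A (g x) * indicator B (g x + y) \<partial>lborel)
        = (\<integral>\<^sup>+x. indicator A (g (- f y + x)) * indicator B (g (- f y + x) + y) \<partial>lborel)"
      by (rule plus[symmetric]) measurable
    also have "\<dots> = (\<integral>\<^sup>+x. indicator A (g x - y) * indicator B (g x) \<partial>lborel)"
      using lin fg by (intro nn_integral_cong) (simp add: linear_add linear_neg linear_diff)
    finally show "(\<integral>\<^sup>+x. indicator A (g x) * indicator B (g x + y) \<partial>lborel)
        = (\<integral>\<^sup>+x. indicator A (g x - y) * indicator B (g x) \<partial>lborel)" .
  qed
  also have "\<dots> = (\<integral>\<^sup>+x. (\<integral>\<^sup>+y. indicator A (g x - y) * indicator B (g x) \<partial>lborel) \<partial>lborel)"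
    by (rule lborel_pair.Fubini') measurable
  also have "\<dots> = (\<integral>\<^sup>+x. emeasure lborel A * indicator B (g x) \<partial>lborel)"
  proof (rule nn_integral_cong)
    fix x
    have "(\<integral>\<^sup>+y. indicator A (g x - y) \<partial>lborel) = (\<integral>\<^sup>+y. indicator A (g x + y) \<partial>lborel)"
      using minus[of "\<lambda>y. indicator A (g x + y)"] by simp
    also have "\<dots> = emeasure lborel A"
      by (simp add: plus)
    finally show "(\<integral>\<^sup>+y. indicator A (g x - y) * indicator B (g x) \<partial>lborel)
        = emeasure lborel A * indicator B (g x)"
      by (simp add: nn_integral_multc)
  qed
  also have "\<dots> = emeasure lborel (f ` B) * emeasure lborel A"
    by (simp add: em nn_integral_cmult mult.commute)
  finally show ?thesis .
qed

text \<open>The factor is \<open>\<bar>det f\<bar>\<close>. In the counting argument below it cancels, and for the coordinate change it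
  is absorbed into a constant.\<close>

lemma linear_image_volume:
  fixes f :: "'a::euclidean_space \<Rightarrow> 'a"
  assumes lin: "linear f" and "inj f"
  obtains \<Delta> where "0 < \<Delta>"
    "\<And>S. bounded S \<Longrightarrow> S \<in> sets borel \<Longrightarrow> f ` S \<in> lmeasurable"
    "\<And>S. bounded S \<Longrightarrow> S \<in> sets borel \<Longrightarrow> measure lebesgue (f ` S) = \<Delta> * measure lebesgue S"
proof -
  obtain g where g: "linear g" "g \<circ> f = id" "f \<circ> g = id"
    using linear_injective_left_inverse[OF lin] linear_inverse_left[OF lin] \<open>inj f\<close> by metis
  have gf: "g (f x) = x" "f (g x) = x" for x
    using g by (metis comp_apply id_apply)+
  have bor: "h ` S \<in> sets borel" if "linear h" "linear k" "\<And>x. h (k x) = x" "\<And>x. k (h x) = x" "S \<in> sets borel" for h k :: "'a \<Rightarrow> 'a" and S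
  proof -
    have "k \<in> borel_measurable borel"
      using that by (auto intro!: borel_measurable_continuous_onI linear_continuous_on simp: linear_linear)
    moreover have "h ` S = k -` S"
      using that(3,4) by (auto simp: image_iff) metis
    ultimately show ?thesis
      using measurable_sets[of k borel borel S] that(5) by simp
  qed
  have bdd: "bounded (h ` S)" if "linear h" "bounded S" for h :: "'a \<Rightarrow> 'a" and S
    using that by (simp add: bounded_linear_image linear_linear)
  let ?U = "box 0 One :: 'a set"
  define \<Delta> where "\<Delta> = measure lborel (f ` ?U)"
  have U1: "emeasure lborel ?U = 1"
    by (simp add: emeasure_lborel_box_eq)
  have scale: "measure lborel (f ` S) = \<Delta> * measure lborel S" if "bounded S" "S \<in> sets borel" for S
  proof -
    have "emeasure lborel (f ` S) * emeasure lborel ?U = emeasure lborel (f ` ?U) * emeasure lborel S"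
      by (rule emeasure_linear_image_proportional[OF lin g(1) gf(2,1)]) (use that in auto)
    then have "enn2real (emeasure lborel (f ` S)) = enn2real (emeasure lborel (f ` ?U) * emeasure lborel S)"
      by (simp add: U1)
    then show ?thesis
      by (simp add: \<Delta>_def measure_def enn2real_mult)
  qed
  have leb: "measure lebesgue S = measure lborel S" if "S \<in> sets borel" for S :: "'a set"
    using that by (simp add: measure_completion)
  show ?thesis
  proof (rule that[of \<Delta>])
    have "f ` (g ` ?U) = ?U"
      by (simp add: image_image gf)
    then have "\<Delta> * measure lborel (g ` ?U) = 1"
      using scale[OF bdd[OF g(1)] bor[OF g(1) lin gf(1,2)], of ?U] U1 by (simp add: measure_def)
    moreover have "0 \<le> \<Delta>"
      by (simp add: \<Delta>_def)
    ultimately show "0 < \<Delta>"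
      by (cases "\<Delta> = 0") auto
    fix S :: "'a set" assume S: "bounded S" "S \<in> sets borel"
    have b: "f ` S \<in> sets borel"
      by (rule bor[OF lin g(1) gf(2,1) S(2)])
    show "measure lebesgue (f ` S) = \<Delta> * measure lebesgue S"
      unfolding leb[OF b] leb[OF S(2)] by (rule scale[OF S])
    show "f ` S \<in> lmeasurable"
      using b bdd[OF lin S(1)] by (intro bounded_set_imp_lmeasurable) auto
  qed
qed

lemma measure_cbox_vec:
  fixes a b :: "real ^ 'n"
  assumes "\<And>i. a $ i \<le> b $ i"
  shows "measure lebesgue (cbox a b) = (\<Prod>i\<in>UNIV. b $ i - a $ i)"
proof -
  have "cbox a b \<noteq> {}"
    using assms by (simp add: interval_ne_empty_cart)
  then show ?thesis
    by (simp add: content_cbox_cart)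
qed

lemma measure_box_vec:
  fixes a b :: "real ^ 'n"
  assumes "\<And>i. a $ i \<le> b $ i"
  shows "measure lebesgue (box a b) = (\<Prod>i\<in>UNIV. b $ i - a $ i)"
proof -
  have "measure lebesgue (box a b) = measure lebesgue (cbox a b)"
    by (simp add: measure_lborel_box_eq measure_lborel_cbox_eq)
  then show ?thesis
    using measure_cbox_vec[OF assms] by simp
qed

lemma card_packing_le:
  fixes F :: "'b \<Rightarrow> (real ^ 'n) set"
  assumes "finite I" "\<And>i. i \<in> I \<Longrightarrow> F i \<in> lmeasurable" "\<And>i. i \<in> I \<Longrightarrow> measure lebesgue (F i) = v"
    and "\<And>i. i \<in> I \<Longrightarrow> F i \<subseteq> K" "K \<in> lmeasurable"
    and disj: "\<And>i j. i \<in> I \<Longrightarrow> j \<in> I \<Longrightarrow> i \<noteq> j \<Longrightarrow> F i \<inter> F j = {}"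
  shows "real (card I) * v \<le> measure lebesgue K"
proof -
  have "real (card I) * v = (\<Sum>i\<in>I. measure lebesgue (F i))"
    using assms(3) by simp
  also have "\<dots> = measure lebesgue (\<Union>(F ` I))"
    by (rule measure_negligible_finite_Union_image[symmetric])
       (use assms disj in \<open>auto simp: pairwise_def\<close>)
  also have "\<dots> \<le> measure lebesgue K"
    using assms by (intro measure_mono_fmeasurable) (auto intro!: sets.finite_UN fmeasurableD)
  finally show ?thesis .
qed

lemma card_vec_box:
  fixes S :: "'n::finite \<Rightarrow> 'a set"
  assumes "\<And>i. finite (S i)"
  shows "finite {c :: 'a ^ 'n. \<forall>i. c $ i \<in> S i}" "card {c :: 'a ^ 'n. \<forall>i. c $ i \<in> S i} = (\<Prod>i\<in>UNIV. card (S i))"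
proof -
  have "bij_betw vec_nth {c :: 'a ^ 'n. \<forall>i. c $ i \<in> S i} (Pi\<^sub>E UNIV S)"
    by (rule bij_betwI[where g = vec_lambda]) auto
  then show "finite {c :: 'a ^ 'n. \<forall>i. c $ i \<in> S i}" "card {c :: 'a ^ 'n. \<forall>i. c $ i \<in> S i} = (\<Prod>i\<in>UNIV. card (S i))"
    using assms by (auto simp: bij_betw_finite bij_betw_same_card card_PiE intro!: finite_PiE)
qed

text \<open>The volume of a parallelepiped depends on its widths only through their product.\<close>

lemma measure_linear_slab_box:
  fixes G :: "real ^ 'n ^ 'n"
  assumes "det G \<noteq> 0"
  obtains \<Delta> where "0 < \<Delta>"
    "\<forall>b. (\<forall>i. 0 \<le> b i) \<longrightarrow> {y. \<forall>i. \<bar>(G *v y) $ i\<bar> \<le> b i} \<in> lmeasurable \<and>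
       measure lebesgue {y. \<forall>i. \<bar>(G *v y) $ i\<bar> \<le> b i} = \<Delta> * (\<Prod>i\<in>UNIV. 2 * b i)"
proof -
  obtain H where H: "H ** G = mat 1" "G ** H = mat 1"
    using assms invertible_det_nz[of G] unfolding invertible_def by blast
  have HG: "H *v (G *v x) = x" "G *v (H *v x) = x" for x
    using H by (simp_all add: matrix_vector_mul_assoc)
  then have "inj ((*v) H)"
    by (metis injI)
  obtain \<Delta> where \<Delta>: "0 < \<Delta>"
    "\<And>S. bounded S \<Longrightarrow> S \<in> sets borel \<Longrightarrow> (*v) H ` S \<in> lmeasurable"
    "\<And>S. bounded S \<Longrightarrow> S \<in> sets borel \<Longrightarrow> measure lebesgue ((*v) H ` S) = \<Delta> * measure lebesgue S"
    using linear_image_volume[OF _ \<open>inj ((*v) H)\<close>] matrix_vector_mul_linear by metis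
  have eq: "{y. \<forall>i. \<bar>(G *v y) $ i\<bar> \<le> b i} = (*v) H ` cbox (\<chi> i. - b i) (\<chi> i. b i)" for b
  proof -
    have "y \<in> (*v) H ` S \<longleftrightarrow> G *v y \<in> S" for y S
      using HG by (auto simp: image_iff) metis
    moreover have "\<bar>u\<bar> \<le> v \<longleftrightarrow> - v \<le> u \<and> u \<le> v" for u v :: real
      by linarith
    ultimately show ?thesis
      unfolding set_eq_iff by (simp add: mem_box_cart)
  qed
  show ?thesis
  proof (rule that[OF \<Delta>(1)], intro allI impI conjI)
    fix b :: "'n \<Rightarrow> real" assume "\<forall>i. 0 \<le> b i"
    then have b: "0 \<le> b i" for i by simp
    show "{y. \<forall>i. \<bar>(G *v y) $ i\<bar> \<le> b i} \<in> lmeasurable"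
      unfolding eq by (intro \<Delta>(2)) auto
    have "measure lebesgue (cbox (\<chi> i. - b i) (\<chi> i. b i) :: (real ^ 'n) set) = (\<Prod>i\<in>UNIV. 2 * b i)"
      by (subst measure_cbox_vec) (auto intro: order_trans[OF _ b] simp: b)
    then show "measure lebesgue {y. \<forall>i. \<bar>(G *v y) $ i\<bar> \<le> b i} = \<Delta> * (\<Prod>i\<in>UNIV. 2 * b i)"
      unfolding eq by (subst \<Delta>(3)) auto
  qed
qed

section \<open>Counting grid cubes that meet a preimage\<close>

text \<open>Half-open cubes of side \<open>1 / q\<close>, indexed by their lower corners in units of \<open>1 / q\<close>, so that
  every point lies in exactly one of them.\<close>

definition grid_cube :: "nat \<Rightarrow> int ^ 'n \<Rightarrow> (real ^ 'n) set" where
  "grid_cube q c = {x. \<forall>i. c $ i = \<lfloor>real q * x $ i\<rfloor>}"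

lemma grid_cube_coordinate_diff:
  assumes "x \<in> grid_cube q c" "y \<in> grid_cube q c" "0 < q"
  shows "\<bar>(x - y) $ i\<bar> \<le> 1 / q"
proof -
  have "\<lfloor>real q * x $ i\<rfloor> = \<lfloor>real q * y $ i\<rfloor>"
    using assms(1,2) by (simp add: grid_cube_def)
  then have "\<bar>real q * x $ i - real q * y $ i\<bar> < 1"
    by linarith
  then have "real q * \<bar>(x - y) $ i\<bar> \<le> 1"
    by (metis abs_mult abs_of_nat less_imp_le right_diff_distrib vector_minus_component)
  then show ?thesis
    using assms(3) by (simp add: field_simps)
qed

text \<open>The grid cubes in the unit cube that meet the preimage under \<open>f\<close> of all integer translates of the
  \<open>r\<close>-ball about \<open>y0\<close>, that is, the preimage of one ball on the torus.\<close>

definition meeting_cubes :: "(real ^ 'n \<Rightarrow> real ^ 'n) \<Rightarrow> real ^ 'n \<Rightarrow> real \<Rightarrow> nat \<Rightarrow> (int ^ 'n) set" where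
  "meeting_cubes f y0 r q = {c. (\<forall>i. c $ i \<in> {0..<int q}) \<and>
     grid_cube q c \<inter> {x. \<exists>m\<in>int_lattice. norm (f x - y0 - m) < r} \<noteq> {}}"

lemma finite_meeting_cubes: "finite (meeting_cubes f y0 r q)"
  by (rule finite_subset[OF _ card_vec_box(1)[of "\<lambda>_. {0..<int q}"]]) (auto simp: meeting_cubes_def)

text \<open>A cube that meets the preimage has its image in a translate of \<open>K\<close>, so images of cubes belonging to
  the same lattice translate of the ball pack into one copy of \<open>K\<close>. To avoid determining how many translates
  the image of a single period sees, the count is carried out in a large box \<open>[0, L)\<^sup>d\<close>: by periodicity
  it contains \<open>L\<^sup>d\<close> copies of the family, while the relevant translates correspond to disjoint unit cubes
  in the image of a slightly larger box, which are at most \<open>\<bar>det f\<bar> * (L + 2 * R)\<^sup>d\<close> in number. The factor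
  \<open>\<bar>det f\<bar>\<close> also occurs in the volume of the image of a cube and cancels; the choice \<open>2 * R \<le> L\<close> costs
  only the factor \<open>2\<^sup>d\<close>.\<close>

lemma card_meeting_cubes_le:
  fixes f :: "real ^ 'n \<Rightarrow> real ^ 'n" and y0 :: "real ^ 'n"
  assumes lin: "linear f" and "inj f"
    and latt: "\<And>x. x \<in> int_lattice \<Longrightarrow> f x \<in> int_lattice"
    and q: "0 < q" and K: "K \<in> lmeasurable"
    and sub: "\<And>u w. norm u < r \<Longrightarrow> (\<And>i. \<bar>w $ i\<bar> \<le> 1 / real q) \<Longrightarrow> u + f w \<in> K"
  shows "real (card (meeting_cubes f y0 r q)) \<le> (2 * real q) ^ CARD('n) * measure lebesgue K"
proof -
  define E where "E = {x. \<exists>m\<in>int_lattice. norm (f x - y0 - m) < r}"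
  let ?d = "CARD('n)" and ?vol = "measure lebesgue K"
  obtain D where D: "0 < D"
    "\<And>S. bounded S \<Longrightarrow> S \<in> sets borel \<Longrightarrow> f ` S \<in> lmeasurable"
    "\<And>S. bounded S \<Longrightarrow> S \<in> sets borel \<Longrightarrow> measure lebesgue (f ` S) = D * measure lebesgue S"
    using linear_image_volume[OF lin \<open>inj f\<close>] by metis
  then obtain g where g: "linear g" "g \<circ> f = id" "f \<circ> g = id"
    using linear_injective_left_inverse[OF lin] linear_inverse_left[OF lin] \<open>inj f\<close> by metis
  have gf: "g (f x) = x" "f (g x) = x" for x
    using g by (metis comp_apply id_apply)+
  obtain Bg where Bg: "Bg > 0" "\<And>x. norm (g x) \<le> Bg * norm x"
    using linear_bounded_pos[OF g(1)] by auto
  \<comment> \<open>Bounds the preimage under \<open>f\<close> of the difference between a point of the unit cube and a vector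
    of length less than \<open>r\<close>.\<close>
  define R where "R = Bg * (\<bar>r\<bar> + ?d)"
  have R0: "0 \<le> R" unfolding R_def using Bg(1) by simp
  obtain L0 :: nat where "2 * R \<le> real L0"
    using real_arch_simple by blast
  define L where "L = Suc L0"
  have L: "2 * R \<le> real L" "0 < L"
    using \<open>2 * R \<le> real L0\<close> by (auto simp: L_def)
  define C0 where "C0 = {c :: int ^ 'n. (\<forall>i. c $ i \<in> {0..<int q}) \<and> grid_cube q c \<inter> E \<noteq> {}}"
  define CL where "CL = {c :: int ^ 'n. (\<forall>i. c $ i \<in> {0..<int (q * L)}) \<and> grid_cube q c \<inter> E \<noteq> {}}"
  define P where "P = {p :: int ^ 'n. \<forall>i. p $ i \<in> {0..<int L}}"
  have cardP: "card P = L ^ ?d" "finite P"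
    unfolding P_def using card_vec_box[of "\<lambda>_. {0..<int L}"] by auto
  have finCL: "finite CL"
    by (rule finite_subset[OF _ card_vec_box(1)[of "\<lambda>_. {0..<int (q * L)}"]]) (auto simp: CL_def)
  \<comment> \<open>Periodicity: translating by the integer vectors of \<open>[0, L)\<^sup>d\<close> yields disjoint copies of the family.\<close>
  have 1: "card C0 * L ^ ?d \<le> card CL"
  proof -
    define h where "h = (\<lambda>(c :: int ^ 'n, p :: int ^ 'n). \<chi> i. c $ i + int q * p $ i)"
    have "inj_on h (C0 \<times> P)"
    proof (rule inj_onI, clarify)
      fix c p c' p' assume cp: "c \<in> C0" "p \<in> P" "c' \<in> C0" "p' \<in> P" "h (c, p) = h (c', p')"
      have "c $ i = c' $ i \<and> p $ i = p' $ i" for i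
      proof -
        have e: "c $ i + int q * p $ i = c' $ i + int q * p' $ i"
          using cp(5) by (simp add: h_def Finite_Cartesian_Product.vec_eq_iff)
        have r: "0 \<le> c $ i" "c $ i < int q" "0 \<le> c' $ i" "c' $ i < int q"
          using cp by (auto simp: C0_def)
        have "c $ i = (c $ i + int q * p $ i) mod int q" "c' $ i = (c' $ i + int q * p' $ i) mod int q"
          using r by (simp_all add: mod_pos_pos_trivial)
        then show ?thesis using e q by auto
      qed
      then show "c = c' \<and> p = p'" by (simp add: Finite_Cartesian_Product.vec_eq_iff)
    qed
    moreover have "h ` (C0 \<times> P) \<subseteq> CL"
    proof clarify
      fix c p assume cp: "c \<in> C0" "p \<in> P"
      then obtain x m where x: "\<And>i. c $ i = \<lfloor>real q * x $ i\<rfloor>" "m \<in> int_lattice" "norm (f x - y0 - m) < r"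
        by (auto simp: C0_def E_def grid_cube_def)
      define p' :: "real ^ 'n" where "p' = (\<chi> i. real_of_int (p $ i))"
      have p': "p' \<in> int_lattice" by (simp add: p'_def int_lattice_def)
      have "f (x + p') - y0 - (m + f p') = f x - y0 - m"
        using lin by (simp add: linear_add)
      then have "norm (f (x + p') - y0 - (m + f p')) < r"
        using x(3) by metis
      then have "x + p' \<in> E"
        unfolding E_def using int_lattice_add[OF x(2) latt[OF p']] by blast
      moreover have "x + p' \<in> grid_cube q (h (c, p))"
      proof -
        have "real q * (x + p') $ i = real q * x $ i + of_int (int q * p $ i)" for i
          by (simp add: p'_def algebra_simps)
        then show ?thesis
          unfolding grid_cube_def h_def using x(1) by (simp del: of_int_mult)
      qed
      moreover have "h (c, p) $ i \<in> {0..<int (q * L)}" for i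
      proof -
        have r: "0 \<le> c $ i" "c $ i < int q" "0 \<le> p $ i" "p $ i < int L"
          using cp by (auto simp: C0_def P_def)
        then have "int q * (p $ i + 1) \<le> int q * int L"
          by (intro mult_left_mono) auto
        then show ?thesis using r by (simp add: h_def algebra_simps)
      qed
      ultimately show "h (c, p) \<in> CL"
        unfolding CL_def by blast
    qed
    ultimately have "card (C0 \<times> P) \<le> card CL"
      using card_inj_on_le finCL by blast
    then show ?thesis by (simp add: card_cartesian_product cardP)
  qed
  have "\<forall>c\<in>CL. \<exists>x m. x \<in> grid_cube q c \<and> m \<in> int_lattice \<and> norm (f x - y0 - m) < r"
    by (auto simp: CL_def E_def)
  then obtain xc mc where xm: "\<And>c. c \<in> CL \<Longrightarrow> xc c \<in> grid_cube q c \<and> mc c \<in> int_lattice \<and> norm (f (xc c) - y0 - mc c) < r"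
    by metis
  \<comment> \<open>The open cubes have the same volume as the half-open ones and are genuine boxes.\<close>
  define cube :: "int ^ 'n \<Rightarrow> (real ^ 'n) set"
    where "cube c = box (\<chi> i. c $ i / q) (\<chi> i. (c $ i + 1) / q)" for c
  have cube_floor: "c $ i = \<lfloor>real q * x $ i\<rfloor>" if "x \<in> cube c" for c x i
    using that q by (auto simp: cube_def mem_box_cart field_simps intro!: floor_unique[symmetric] less_imp_le)
  have cube_measure: "measure lebesgue (cube c) = (1 / real q) ^ ?d" for c
  proof -
    have "measure lebesgue (cube c) = (\<Prod>i\<in>(UNIV::'n set). (c $ i + 1) / q - c $ i / q)"
      unfolding cube_def by (subst measure_box_vec) (auto simp: divide_right_mono)
    also have "\<dots> = (\<Prod>i\<in>(UNIV::'n set). 1 / q)"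
      by (intro prod.cong) (auto simp: add_divide_distrib)
    finally show ?thesis by simp
  qed
  \<comment> \<open>Images of cubes that belong to the same translate of the ball pack into one copy of \<open>K\<close>.\<close>
  have 2: "real (card {c \<in> CL. mc c = m}) * (D * (1 / real q) ^ ?d) \<le> ?vol" for m
  proof -
    have "real (card {c \<in> CL. mc c = m}) * (D * (1 / real q) ^ ?d) \<le> measure lebesgue ((+) (y0 + m) ` K)"
    proof (rule card_packing_le[where F = "\<lambda>c. f ` cube c"])
      show "finite {c \<in> CL. mc c = m}" using finCL by simp
      show "f ` cube c \<in> lmeasurable" for c
        unfolding cube_def by (intro D(2)) auto
      show "measure lebesgue (f ` cube c) = D * (1 / real q) ^ ?d" for c
        using D(3)[of "cube c"] cube_measure[of c] by (simp add: cube_def)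
      show "(+) (y0 + m) ` K \<in> lmeasurable"
        using K by (rule measurable_translation)
      show "f ` cube c \<inter> f ` cube c' = {}" if "c \<noteq> c'" for c c'
      proof -
        have "cube c \<inter> cube c' = {}"
        proof (rule equals0I)
          fix x assume "x \<in> cube c \<inter> cube c'"
          then have "c = c'" using cube_floor[of x c] cube_floor[of x c'] by (simp add: Finite_Cartesian_Product.vec_eq_iff)
          then show False using that by simp
        qed
        then show ?thesis
          using image_Int[OF \<open>inj f\<close>, of "cube c" "cube c'"] by simp
      qed
      show "f ` cube c \<subseteq> (+) (y0 + m) ` K" if c: "c \<in> {c \<in> CL. mc c = m}" for c
      proof clarify
        fix y assume y: "y \<in> cube c"
        let ?x = "xc c"
        have x: "?x \<in> grid_cube q c" "norm (f ?x - y0 - m) < r"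
          using xm[of c] c by auto
        have "y \<in> grid_cube q c"
          using cube_floor[OF y] by (simp add: grid_cube_def)
        then have "\<bar>(y - ?x) $ i\<bar> \<le> 1 / real q" for i
          using x(1) q by (rule grid_cube_coordinate_diff)
        from sub[OF x(2) this] have "f y - y0 - m \<in> K"
          using lin by (simp add: linear_diff algebra_simps)
        moreover have "f y = (y0 + m) + (f y - y0 - m)" by simp
        ultimately show "f y \<in> (+) (y0 + m) ` K" by blast
      qed
    qed
    then show ?thesis by (simp only: measure_translation)
  qed
  \<comment> \<open>Distinct translates give disjoint unit cubes, all within the image of an enlarged box.\<close>
  have 3: "real (card (mc ` CL)) \<le> D * (real L + 2 * R) ^ ?d"
  proof -
    let ?B = "cbox (\<chi> i. - R) (\<chi> i. real L + R) :: (real ^ 'n) set"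
    have "real (card (mc ` CL)) * 1 \<le> measure lebesgue (f ` ?B)"
    proof (rule card_packing_le[where F = "\<lambda>m. (+) (y0 + m) ` box 0 1"])
      show "finite (mc ` CL)" using finCL by simp
      show "(+) (y0 + m) ` box 0 1 \<in> lmeasurable" for m :: "real ^ 'n"
        by (intro measurable_translation) auto
      show "measure lebesgue ((+) (y0 + m) ` box 0 1) = 1" for m :: "real ^ 'n"
        unfolding measure_translation by (subst measure_box_vec) auto
      show "f ` ?B \<in> lmeasurable"
        by (intro D(2)) auto
      show "(+) (y0 + m) ` box 0 1 \<inter> (+) (y0 + m') ` box 0 1 = {}"
        if m: "m \<in> mc ` CL" "m' \<in> mc ` CL" "m \<noteq> m'" for m m'
      proof (rule equals0I)
        have ml: "m \<in> int_lattice" "m' \<in> int_lattice"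
          using m xm by auto
        fix x assume "x \<in> (+) (y0 + m) ` box 0 1 \<inter> (+) (y0 + m') ` box 0 1"
        then obtain v v' where v: "v \<in> box 0 1" "v' \<in> box 0 1" "m + v = m' + v'"
          by (auto simp: add.assoc)
        have "m $ i = m' $ i" for i
        proof -
          obtain a a' where a: "m $ i = of_int a" "m' $ i = of_int a'"
            using ml unfolding int_lattice_def by (metis Ints_cases mem_Collect_eq)
          have "m $ i + v $ i = m' $ i + v' $ i"
            using v(3) by (metis vector_add_component)
          moreover have "0 < v $ i" "v $ i < 1" "0 < v' $ i" "v' $ i < 1"
            using v(1,2) by (auto simp: mem_box_cart)
          ultimately have "\<bar>of_int a - (of_int a' :: real)\<bar> < 1"
            unfolding a by linarith
          then have "a = a'" by linarith
          then show ?thesis unfolding a by simp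
        qed
        then show False using m(3) by (simp add: Finite_Cartesian_Product.vec_eq_iff)
      qed
      show "(+) (y0 + m) ` box 0 1 \<subseteq> f ` ?B" if m: "m \<in> mc ` CL" for m
      proof clarify
        fix v :: "real ^ 'n" assume v: "v \<in> box 0 1"
        obtain c where c: "c \<in> CL" "m = mc c" using m by blast
        let ?x = "xc c"
        have x: "?x \<in> grid_cube q c" "norm (f ?x - y0 - m) < r"
          using xm[OF c(1)] c(2) by auto
        define e where "e = v - (f ?x - y0 - m)"
        have "norm v \<le> (\<Sum>i\<in>UNIV. \<bar>v $ i\<bar>)" by (rule norm_le_l1_cart)
        also have "\<dots> \<le> (\<Sum>i\<in>(UNIV::'n set). 1)"
          using v by (intro sum_mono) (auto simp: mem_box_cart less_imp_le)
        finally have "norm v \<le> ?d" by simp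
        then have "norm e \<le> \<bar>r\<bar> + ?d"
          unfolding e_def using x(2) norm_triangle_ineq4[of v "f ?x - y0 - m"] by linarith
        then have ge: "norm (g e) \<le> R"
          unfolding R_def using Bg by (meson mult_left_mono less_imp_le order_trans)
        have "?x + g e \<in> ?B"
        proof -
          have "- R \<le> (?x + g e) $ i \<and> (?x + g e) $ i \<le> real L + R" for i
          proof -
            have "c $ i = \<lfloor>real q * ?x $ i\<rfloor>" "0 \<le> c $ i" "c $ i < int (q * L)"
              using x(1) c(1) by (auto simp: grid_cube_def CL_def)
            then have "0 \<le> real q * ?x $ i" "real q * ?x $ i < real_of_int (int (q * L))"
              by (simp_all only: le_floor_iff floor_less_iff of_int_0)
            then have "0 \<le> ?x $ i" "?x $ i \<le> L"
              using q by (auto simp: zero_le_mult_iff)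
            then show ?thesis
              using component_le_norm_cart[of "g e" i] ge by (auto simp: abs_le_iff)
          qed
          then show ?thesis by (simp add: mem_box_cart)
        qed
        moreover have "f (?x + g e) = y0 + m + v"
          using lin by (simp add: linear_add gf e_def)
        ultimately show "y0 + m + v \<in> f ` ?B" by (metis imageI)
      qed
    qed
    also have "measure lebesgue (f ` ?B) = D * (real L + 2 * R) ^ ?d"
      using R0 by (subst D(3)) (auto simp: measure_cbox_vec add.commute simp del: measure_completion)
    finally show ?thesis by simp
  qed
  have "real (card CL) * (D * (1 / real q) ^ ?d) = (\<Sum>m\<in>mc ` CL. real (card {c \<in> CL. mc c = m}) * (D * (1 / real q) ^ ?d))"
    using sum.image_gen[OF finCL, of "\<lambda>_. 1 :: real" mc] by (simp add: sum_distrib_right)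
  also have "\<dots> \<le> (\<Sum>m\<in>mc ` CL. ?vol)"
    by (intro sum_mono 2)
  also have "\<dots> = real (card (mc ` CL)) * ?vol"
    by simp
  also have "\<dots> \<le> D * (real L + 2 * R) ^ ?d * ?vol"
    by (intro mult_right_mono 3) auto
  also have "\<dots> \<le> D * (2 * real L) ^ ?d * ?vol"
    using L R0 by (intro mult_right_mono mult_left_mono power_mono less_imp_le[OF D(1)]) auto
  finally have "D * (real (card CL) * (1 / real q) ^ ?d) \<le> D * ((2 * real L) ^ ?d * ?vol)"
    by (simp add: mult_ac)
  then have "real (card CL) * (1 / real q) ^ ?d \<le> (2 * real L) ^ ?d * ?vol"
    using D(1) by (simp only: mult_le_cancel_left_pos)
  then have "real (card CL) \<le> real q ^ ?d * ((2 * real L) ^ ?d * ?vol)"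
    using q by (simp add: power_one_over field_simps)
  moreover have "real (card C0) * real L ^ ?d \<le> real (card CL)"
    using 1 by (metis of_nat_le_iff of_nat_mult of_nat_power)
  ultimately have "real (card C0) * real L ^ ?d \<le> ((2 * real q) ^ ?d * ?vol) * real L ^ ?d"
    by (simp add: power_mult_distrib mult_ac)
  then have "real (card C0) \<le> (2 * real q) ^ ?d * ?vol"
    using L(2) by (simp only: mult_le_cancel_right_pos zero_less_power of_nat_0_less_iff)
  then show ?thesis
    by (simp add: C0_def meeting_cubes_def E_def)
qed

section \<open>Hausdorff measure of limit superior sets\<close>

lemma hausdorff_gauge_le:
  assumes "0 < s" "bounded U" "diameter U \<le> \<delta>"
  shows "hausdorff_gauge s U \<le> ennreal (\<delta> powr s)"
  using assms diameter_ge_0[OF assms(2)]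
  by (auto simp: hausdorff_gauge_def intro!: ennreal_leI powr_mono2)

text \<open>The convergence half of Borel--Cantelli for Hausdorff measure: the covers of all levels beyond a large
  \<open>M\<close> together cover \<open>S\<close>, and their total gauge is a tail of a convergent series. The finite families are
  merged into one sequence by the pairing function on \<open>nat\<close>, with empty sets as padding.\<close>

lemma hausdorff_measure_limsup_eq_0:
  fixes S :: "'a::metric_space set" and F :: "nat \<Rightarrow> 'a set set" and \<delta> :: "nat \<Rightarrow> real"
  assumes s: "0 < s" and fin: "\<And>n. finite (F n)"
    and cover: "\<And>x. x \<in> S \<Longrightarrow> \<exists>\<^sub>\<infinity>n. x \<in> \<Union>(F n)"
    and small: "\<And>n U. U \<in> F n \<Longrightarrow> bounded U \<and> diameter U \<le> \<delta> n"
    and lim: "\<delta> \<longlonglongrightarrow> 0"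
    and sm: "summable (\<lambda>n. real (card (F n)) * \<delta> n powr s)"
  shows "hausdorff_measure s S = 0"
proof -
  have "hausdorff_premeasure s \<delta>0 S \<le> ennreal e" if d0: "0 < \<delta>0" and e0: "0 < e" for \<delta>0 e :: real
  proof -
    let ?a = "\<lambda>n. real (card (F n)) * \<delta> n powr s"
    have "\<forall>\<^sub>F n in sequentially. \<delta> n < \<delta>0"
      using order_tendstoD(2)[OF lim d0] .
    then obtain M1 where M1: "\<And>n. n \<ge> M1 \<Longrightarrow> \<delta> n < \<delta>0"
      by (auto simp: eventually_sequentially)
    obtain M2 where M2: "\<And>n. n \<ge> M2 \<Longrightarrow> norm (\<Sum>i. ?a (i + n)) < e"
      using suminf_exist_split[OF e0 sm] by auto
    define M where "M = max M1 M2"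
    have "\<forall>n. \<exists>h. bij_betw h {0..<card (F n)} (F n)"
      using ex_bij_betw_nat_finite[OF fin] by blast
    then obtain h where h: "\<And>n. bij_betw (h n) {0..<card (F n)} (F n)"
      by metis
    have hF: "h n j \<in> F n" if "j < card (F n)" for n j
      using h[of n] that by (auto simp: bij_betw_def)
    define V where "V = (\<lambda>(n, j). if j < card (F (n + M)) then h (n + M) j else {})"
    have "hausdorff_premeasure s \<delta>0 S \<le> (\<Sum>i. hausdorff_gauge s (V (prod_decode i)))"
      unfolding hausdorff_premeasure_def
    proof (rule INF_lower, intro CollectI conjI allI)
      show "S \<subseteq> (\<Union>i. V (prod_decode i))"
      proof
        fix x assume "x \<in> S"
        then obtain n U where n: "n \<ge> M" "U \<in> F n" "x \<in> U"
          using cover unfolding INFM_nat_le by blast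
        have "U \<in> h n ` {0..<card (F n)}"
          using h[of n] n(2) by (simp add: bij_betw_def)
        then obtain j where j: "j < card (F n)" "h n j = U"
          by auto
        have "x \<in> V (prod_decode (prod_encode (n - M, j)))"
          using n j by (simp add: V_def)
        then show "x \<in> (\<Union>i. V (prod_decode i))"
          by blast
      qed
      fix i
      obtain n j where nj: "prod_decode i = (n, j)"
        by fastforce
      have "\<delta> (n + M) < \<delta>0"
        by (rule M1) (simp add: M_def)
      then have "diameter (h (n + M) j) \<le> \<delta>0" "bounded (h (n + M) j)" if "j < card (F (n + M))"
        using small[OF hF[OF that]] by auto
      then show "bounded (V (prod_decode i))" "diameter (V (prod_decode i)) \<le> \<delta>0"
        using \<open>0 < \<delta>0\<close> by (auto simp: nj V_def)
    qed
    also have "\<dots> = (\<Sum>n. \<Sum>j. hausdorff_gauge s (V (n, j)))"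
      by (rule suminf_ennreal_2dimen) simp
    also have "\<dots> \<le> (\<Sum>n. ennreal (?a (n + M)))"
    proof (rule suminf_le)
      fix n
      let ?c = "card (F (n + M))"
      have "(\<Sum>j. hausdorff_gauge s (V (n, j))) = (\<Sum>j<?c. hausdorff_gauge s (V (n, j)))"
        by (rule suminf_finite) (auto simp: V_def hausdorff_gauge_def)
      also have "\<dots> \<le> (\<Sum>j<?c. ennreal (\<delta> (n + M) powr s))"
        using small[OF hF] s by (intro sum_mono) (auto simp: V_def intro!: hausdorff_gauge_le)
      also have "\<dots> = ennreal (?a (n + M))"
        by (simp add: ennreal_mult ennreal_of_nat_eq_real_of_nat)
      finally show "(\<Sum>j. hausdorff_gauge s (V (n, j))) \<le> ennreal (?a (n + M))" .
    qed auto
    also have "\<dots> = ennreal (\<Sum>n. ?a (n + M))"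
      using sm by (intro suminf_ennreal2) (auto simp: summable_iff_shift[of ?a M])
    also have "\<dots> \<le> ennreal e"
      using M2[of M] by (intro ennreal_leI) (auto simp: M_def)
    finally show ?thesis .
  qed
  then have "hausdorff_premeasure s \<delta>0 S = 0" if "0 < \<delta>0" for \<delta>0
    using that by (metis ennreal_0 ennreal_le_epsilon le_zero_eq add_0 ennreal_less_top)
  then show ?thesis
    unfolding hausdorff_measure_def by (simp add: SUP_eq_iff)
qed

section \<open>Grid cubes on the torus\<close>

lemma funpow_linear:
  fixes f :: "'a::real_vector \<Rightarrow> 'a"
  assumes "linear f"
  shows "linear (f ^^ n)"
proof (induction n)
  case 0
  show ?case by (rule linearI) simp_all
next
  case (Suc n)
  then show ?case using linear_compose[OF Suc assms] by (simp add: comp_def)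
qed

lemma torus_map_funpow:
  "(torus_map A ^^ n) (abs_torus x) = abs_torus (((*v) (map_matrix real_of_int A) ^^ n) x)"
  by (induction n) (simp_all add: torus_map.abs_eq)

lemma dist_abs_torus_le: "dist (abs_torus x) (abs_torus y) \<le> norm (x - y)"
  using infdist_le[OF int_lattice_zero, of "x - y"]
  by (simp add: dist_torus.abs_eq infdist_int_lattice)

lemma dist_abs_torus_less:
  assumes "dist (abs_torus x) (abs_torus y) < r"
  obtains m where "m \<in> int_lattice" "norm (y - x - m) < r"
proof -
  obtain k where k: "k \<in> int_lattice" "infdist (x - y) int_lattice = dist (x - y) k"
    using infdist_attains_inf[OF closed_int_lattice int_lattice_nonempty] by blast
  have "norm (x - y - k) < r"
    using assms k(2) by (simp add: dist_torus.abs_eq infdist_int_lattice dist_norm)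
  moreover have "norm (y - x - (- k)) = norm (x - y - k)"
    using norm_minus_cancel[of "x - y - k"] by (simp add: algebra_simps)
  ultimately show ?thesis
    using that[of "- k"] int_lattice_uminus[OF k(1)] by simp
qed

lemma torus_representative:
  obtains x where "X = abs_torus x" "\<And>i. 0 \<le> x $ i" "\<And>i. x $ i < 1"
proof -
  obtain y where y: "X = abs_torus y"
    using torus.abs_induct[of "\<lambda>X. \<exists>y. X = abs_torus y" X] by blast
  define x where "x = (\<chi> i. frac (y $ i))"
  have "torus_rel y x"
    by (auto simp: torus_rel_def int_lattice_def x_def frac_def)
  then have "X = abs_torus x"
    using y by (simp add: torus.abs_eq_iff)
  then show ?thesis
    by (rule that) (auto simp: x_def frac_lt_1)
qed

lemma grid_cube_norm_le:
  fixes x y :: "real ^ 'n"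
  assumes "x \<in> grid_cube q c" "y \<in> grid_cube q c" "0 < q"
  shows "norm (x - y) \<le> CARD('n) / q"
proof -
  have "(\<Sum>i\<in>UNIV. \<bar>(x - y) $ i\<bar>) \<le> (\<Sum>i\<in>(UNIV::'n set). 1 / q)"
    by (intro sum_mono grid_cube_coordinate_diff[OF assms])
  then show ?thesis
    using norm_le_l1_cart[of "x - y"] by simp
qed

text \<open>The cubes counted above cover, after projection, the preimage of a ball on the torus: every point has a
  representative in the unit cube.\<close>

lemma meeting_cubes_cover:
  assumes "0 < q" and "dist (abs_torus y0) ((torus_map A ^^ n) X) < r"
  shows "X \<in> (\<Union>c\<in>meeting_cubes ((*v) (map_matrix real_of_int A) ^^ n) y0 r q. abs_torus ` grid_cube q c)"
proof -
  obtain x where x: "X = abs_torus x" "\<And>i. 0 \<le> x $ i" "\<And>i. x $ i < 1"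
    using torus_representative by metis
  define c where "c = (\<chi> i. \<lfloor>real q * x $ i\<rfloor>)"
  have xc: "x \<in> grid_cube q c"
    by (simp add: c_def grid_cube_def)
  have "dist (abs_torus y0) (abs_torus (((*v) (map_matrix real_of_int A) ^^ n) x)) < r"
    using assms(2) by (simp add: x(1) torus_map_funpow)
  then obtain m where "m \<in> int_lattice" "norm (((*v) (map_matrix real_of_int A) ^^ n) x - y0 - m) < r"
    by (rule dist_abs_torus_less)
  moreover have "c $ i \<in> {0..<int q}" for i
  proof -
    have "real q * x $ i < real q"
      using x(3)[of i] assms(1) by simp
    then show ?thesis
      using x(2)[of i] by (simp add: c_def floor_less_iff)
  qed
  ultimately have "c \<in> meeting_cubes ((*v) (map_matrix real_of_int A) ^^ n) y0 r q"
    unfolding meeting_cubes_def using xc by blast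
  then show ?thesis
    using xc x(1) by blast
qed

section \<open>Ordered triangularization\<close>

text \<open>An enumeration of the index type carries the Leibniz formula for type-indexed matrices to the one for
  matrices indexed by numbers.\<close>

lemma det_mat_reindex:
  fixes M :: "'a::comm_ring_1 ^ 'n ^ 'n" and e :: "nat \<Rightarrow> 'n"
  assumes e: "bij_betw e {0..<CARD('n)} UNIV"
  shows "Determinant.det (Matrix.mat CARD('n) CARD('n) (\<lambda>(i, j). M $ e i $ e j)) = det M"
proof -
  let ?A = "{0..<CARD('n)}"
  let ?g = "inv_into ?A e"
  have g: "bij_betw ?g UNIV ?A"
    by (rule bij_betw_inv_into[OF e])
  have inj: "inj_on e ?A"
    using e by (simp add: bij_betw_def)
  have eg: "e (?g x) = x" for x
    using bij_betw_inv_into_right[OF e] by simp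
  have ge: "?g (e i) = i" if "i \<in> ?A" for i
    using bij_betw_inv_into_left[OF e that] .
  have g_in: "?g x \<in> ?A" for x
    using g by (auto simp: bij_betw_def)
  have "Determinant.det (Matrix.mat CARD('n) CARD('n) (\<lambda>(i, j). M $ e i $ e j))
      = (\<Sum>p | p permutes ?A. of_int (sign p) * (\<Prod>i\<in>?A. M $ e i $ e (p i)))"
    unfolding Determinant.det_def
    by (auto intro!: sum.cong prod.cong simp: permutes_in_image)
  also have "\<dots> = (\<Sum>p | p permutes (UNIV :: 'n set). of_int (sign p) * (\<Prod>i\<in>UNIV. M $ i $ p i))"
  proof (rule sum.reindex_bij_witness[where i = "map_permutation UNIV ?g" and j = "map_permutation ?A e"])
    fix p assume "p \<in> {p. p permutes ?A}"
    then have p: "p permutes ?A" by simp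
    show "map_permutation UNIV ?g (map_permutation ?A e p) = p"
      by (rule map_permutation_compose_inv[OF e p]) (rule ge)
    show "map_permutation ?A e p \<in> {p. p permutes (UNIV :: 'n set)}"
      using map_permutation_permutes[OF e p] by simp
    have "(\<Prod>i\<in>?A. M $ e i $ e (p i)) = (\<Prod>i\<in>?A. M $ e i $ (map_permutation ?A e p (e i)))"
      by (intro prod.cong refl) (simp add: map_permutation_apply[OF inj])
    also have "\<dots> = (\<Prod>i\<in>UNIV. M $ i $ map_permutation ?A e p i)"
      by (rule prod.reindex_bij_betw[OF e])
    finally show "of_int (sign (map_permutation ?A e p)) * (\<Prod>i\<in>UNIV. M $ i $ map_permutation ?A e p i)
        = of_int (sign p) * (\<Prod>i\<in>?A. M $ e i $ e (p i))"
      by (simp add: sign_map_permutation[OF inj p])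
  next
    fix p :: "'n \<Rightarrow> 'n" assume "p \<in> {p. p permutes UNIV}"
    then have p: "p permutes UNIV" by simp
    show "map_permutation ?A e (map_permutation UNIV ?g p) = p"
      by (rule map_permutation_compose_inv[OF g p]) (rule eg)
    show "map_permutation UNIV ?g p \<in> {p. p permutes ?A}"
      using map_permutation_permutes[OF g p] by simp
  qed
  finally show ?thesis
    by (simp add: Determinants.det_def)
qed

lemma charpoly_mat_reindex:
  fixes M :: "'a::comm_ring_1 ^ 'n ^ 'n" and e :: "nat \<Rightarrow> 'n"
  assumes e: "bij_betw e {0..<CARD('n)} UNIV"
  shows "char_poly (Matrix.mat CARD('n) CARD('n) (\<lambda>(i, j). M $ e i $ e j)) = charpoly M"
proof -
  let ?d = "CARD('n)"
  have inj: "e i = e j \<longleftrightarrow> i = j" if "i < ?d" "j < ?d" for i j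
    using e that by (auto simp: bij_betw_def inj_on_def)
  have "char_poly_matrix (Matrix.mat ?d ?d (\<lambda>(i, j). M $ e i $ e j))
      = Matrix.mat ?d ?d (\<lambda>(i, j). (mat [:0, 1:] - map_matrix (\<lambda>a. [:a:]) M) $ e i $ e j)"
    by (rule eq_matI)
      (auto simp: char_poly_matrix_def inj Finite_Cartesian_Product.mat_def map_matrix_def)
  then show ?thesis
    unfolding char_poly_def charpoly_def by (simp only: det_mat_reindex[OF e])
qed

text \<open>Schur triangularization of the complex matrix, read row by row: the rows \<open>p\<^sub>i\<close> of \<open>P\<close> are independent
  linear forms, and \<open>p\<^sub>i A\<close> is \<open>lam (\<sigma> i) p\<^sub>i\<close> plus a combination of forms \<open>p\<^sub>j\<close> with \<open>\<sigma> j < \<sigma> i\<close>. The point is that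
  the eigenvalues can be made to appear in the prescribed order, so that when their moduli increase
  with the index, each form is perturbed only by forms that grow no faster.\<close>

lemma schur_triangularization:
  fixes A :: "complex ^ 'n ^ 'n" and lam :: "nat \<Rightarrow> complex"
  assumes cp: "charpoly A = (\<Prod>j\<in>{1..CARD('n)}. [:- lam j, 1:])"
  obtains P B :: "complex ^ 'n ^ 'n" and \<sigma> :: "'n \<Rightarrow> nat"
  where "bij_betw \<sigma> UNIV {1..CARD('n)}" "det P \<noteq> 0" "P ** A = B ** P"
    "\<And>i. B $ i $ i = lam (\<sigma> i)" "\<And>i j. \<sigma> i < \<sigma> j \<Longrightarrow> B $ i $ j = 0"
    "det A = (\<Prod>j\<in>{1..CARD('n)}. lam j)"
proof -
  let ?d = "CARD('n)"
  obtain e :: "nat \<Rightarrow> 'n" where e: "bij_betw e {0..<?d} UNIV"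
    using ex_bij_betw_nat_finite[of "UNIV :: 'n set"] by auto
  define g where "g = inv_into {0..<?d} e"
  have g: "bij_betw g UNIV {0..<?d}"
    unfolding g_def by (rule bij_betw_inv_into[OF e])
  have eg [simp]: "e (g x) = x" for x
    unfolding g_def using bij_betw_inv_into_right[OF e] by simp
  have ge [simp]: "g (e i) = i" if "i < ?d" for i
    unfolding g_def using bij_betw_inv_into_left[OF e] that by simp
  have g_lt [simp]: "g x < ?d" for x
    using g by (auto simp: bij_betw_def)
  define A' where "A' = Matrix.mat ?d ?d (\<lambda>(i, j). A $ e i $ e j)"
  have A': "A' \<in> carrier_mat ?d ?d"
    by (simp add: A'_def)
  \<comment> \<open>An upper triangular matrix couples row \<open>i\<close> to the later rows, so the eigenvalues are listed in
    decreasing order of index.\<close>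
  define es where "es = map (\<lambda>i. lam (?d - i)) [0..<?d]"
  have "(\<Prod>a\<leftarrow>es. [:- a, 1:]) = (\<Prod>i\<in>{0..<?d}. [:- lam (?d - i), 1:])"
    using prod.distinct_set_conv_list[of "[0..<?d]" "\<lambda>i. [:- lam (?d - i), 1:]"]
    by (simp add: es_def comp_def)
  also have "\<dots> = (\<Prod>j\<in>{1..?d}. [:- lam j, 1:])"
    by (rule prod.reindex_bij_witness[where i = "\<lambda>j. ?d - j" and j = "\<lambda>j. ?d - j"]) auto
  finally have cp': "char_poly A' = (\<Prod>a\<leftarrow>es. [:- a, 1:])"
    unfolding A'_def charpoly_mat_reindex[OF e] cp by simp
  obtain B' P' Q where S: "schur_decomposition A' es = (B', P', Q)"
    by (metis prod_cases3)
  note sd = schur_decomposition[OF A' cp' S]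
  then have sim: "similar_mat_wit A' B' P' Q" and ut: "upper_triangular B'" and dg: "diag_mat B' = es"
    by auto
  note sw = similar_mat_witD2[OF A' sim]
  define P where "P = (\<chi> i j. Q $$ (g i, g j))"
  define B where "B = (\<chi> i j. B' $$ (g i, g j))"
  define \<sigma> where "\<sigma> i = ?d - g i" for i
  have mult: "(\<Sum>k\<in>UNIV. X (g i, g k) * Y (g k, g j)) = (\<Sum>k = 0..<?d. X (g i, k) * Y (k, g j))"
    for X Y :: "nat \<times> nat \<Rightarrow> complex" and i j
    by (rule sum.reindex_bij_betw[OF g])
  have QA: "Q * A' = B' * Q"
  proof -
    have "Q * A' = Q * (P' * (B' * Q))"
      using sw by (metis assoc_mult_mat)
    also have "\<dots> = (Q * P') * (B' * Q)"
      using sw by (subst assoc_mult_mat[of _ ?d ?d _ ?d _ ?d]) auto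
    also have "\<dots> = B' * Q"
      using sw by (simp add: left_mult_one_mat[OF mult_carrier_mat[of _ ?d ?d]])
    finally show ?thesis .
  qed
  show ?thesis
  proof (rule that)
    show "bij_betw \<sigma> UNIV {1..?d}"
    proof -
      have "bij_betw (\<lambda>i. ?d - i) {0..<?d} {1..?d}"
        by (rule bij_betwI[where g = "\<lambda>i. ?d - i"]) auto
      from bij_betw_trans[OF g this] show ?thesis
        by (simp add: \<sigma>_def[abs_def] comp_def)
    qed
    have "Q = Matrix.mat ?d ?d (\<lambda>(i, j). P $ e i $ e j)"
      using sw by (intro eq_matI) (auto simp: P_def)
    then have "det P = Determinant.det Q"
      using det_mat_reindex[OF e, of P] by simp
    moreover have "Determinant.det P' * Determinant.det Q = 1"
      using sw by (metis det_mult det_one)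
    ultimately show "det P \<noteq> 0"
      by auto
    show "P ** A = B ** P"
    proof -
      have "(P ** A) $ i $ j = (B ** P) $ i $ j" for i j
      proof -
        have "(P ** A) $ i $ j = (\<Sum>k\<in>UNIV. Q $$ (g i, g k) * A' $$ (g k, g j))"
          by (simp add: matrix_matrix_mult_def P_def A'_def)
        also have "\<dots> = (Q * A') $$ (g i, g j)"
          unfolding mult using sw A' by (simp add: scalar_prod_def)
        also have "\<dots> = (\<Sum>k\<in>UNIV. B' $$ (g i, g k) * Q $$ (g k, g j))"
          unfolding mult QA using sw by (simp add: scalar_prod_def)
        also have "\<dots> = (B ** P) $ i $ j"
          by (simp add: matrix_matrix_mult_def P_def B_def)
        finally show ?thesis .
      qed
      then show ?thesis
        by (simp add: Finite_Cartesian_Product.vec_eq_iff)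
    qed
    show "B $ i $ i = lam (\<sigma> i)" for i
    proof -
      have "diag_mat B' ! g i = es ! g i"
        by (simp add: dg)
      then show ?thesis
        using sw by (simp add: diag_mat_def es_def B_def \<sigma>_def)
    qed
    show "B $ i $ j = 0" if "\<sigma> i < \<sigma> j" for i j
      using that ut sw g_lt[of i] unfolding B_def \<sigma>_def upper_triangular_def by auto
    have "det A = Determinant.det A'"
      unfolding A'_def det_mat_reindex[OF e] ..
    also have "\<dots> = Determinant.det B'"
      using sim by (intro det_similar) (auto simp: similar_mat_def)
    also have "\<dots> = prod_list es"
      using det_upper_triangular[OF ut] sw dg by auto
    also have "\<dots> = (\<Prod>i\<in>{0..<?d}. lam (?d - i))"
        using prod.distinct_set_conv_list[of "[0..<?d]" "\<lambda>i. lam (?d - i)"] by (simp add: es_def)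
    also have "\<dots> = (\<Prod>j\<in>{1..?d}. lam j)"
      by (rule prod.reindex_bij_witness[where i = "\<lambda>j. ?d - j" and j = "\<lambda>j. ?d - j"]) auto
    finally show "det A = (\<Prod>j\<in>{1..?d}. lam j)" .
  qed
qed

section \<open>Real coordinates adapted to the eigenvalues\<close>

lemma det_map_matrix_of_real:
  fixes G :: "real ^ 'n ^ 'n"
  shows "det (map_matrix complex_of_real G) = complex_of_real (det G)"
  by (simp add: Determinants.det_def map_matrix_def)

lemma det_map_matrix_of_int:
  fixes G :: "int ^ 'n ^ 'n"
  shows "det (map_matrix (of_int :: int \<Rightarrow> 'a::comm_ring_1) G) = of_int (det G)"
  by (simp add: Determinants.det_def map_matrix_def)

text \<open>By multilinearity, the determinant of a matrix with row \<open>u + \<i> v\<close> is a combination of the determinants with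
  row \<open>u\<close> and row \<open>v\<close>, so one of these is nonzero. Replacing the rows one after another by their real or
  imaginary parts thus keeps the determinant nonzero, and the real forms obtained are bounded by the
  complex ones on real vectors. This moves growth estimates from complex to real coordinates.\<close>

lemma nonsingular_real_rows:
  fixes P :: "complex ^ 'n ^ 'n"
  assumes "det P \<noteq> 0"
  obtains G :: "real ^ 'n ^ 'n" where "det G \<noteq> 0"
    "\<And>x i. \<bar>(G *v x) $ i\<bar> \<le> cmod ((P *v (\<chi> j. complex_of_real (x $ j))) $ i)"
proof -
  define real_row where "real_row = (\<lambda>(r :: complex ^ 'n) p.
      r = (\<chi> j. of_real (Re (p $ j))) \<or> r = (\<chi> j. of_real (Im (p $ j))))"
  \<comment> \<open>\<open>S\<close> is the set of rows that have been replaced.\<close>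
  have "\<exists>Q. det Q \<noteq> 0 \<and> (\<forall>i\<in>S. real_row (Q $ i) (P $ i)) \<and> (\<forall>i. i \<notin> S \<longrightarrow> Q $ i = P $ i)"
    if "finite S" for S
    using that
  proof (induction S rule: finite_induct)
    case empty
    then show ?case using assms by auto
  next
    case (insert k S)
    then obtain Q where Q: "det Q \<noteq> 0" "\<forall>i\<in>S. real_row (Q $ i) (P $ i)" "\<forall>i. i \<notin> S \<longrightarrow> Q $ i = P $ i"
      by auto
    define R where "R = (\<lambda>r. (\<chi> i. if i = k then r else Q $ i))"
    define re where "re = ((\<chi> j. of_real (Re (P $ k $ j))) :: complex ^ 'n)"
    define im where "im = ((\<chi> j. of_real (Im (P $ k $ j))) :: complex ^ 'n)"
    have Pk: "P $ k = re + \<i> *s im"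
      by (simp add: re_def im_def Finite_Cartesian_Product.vec_eq_iff complex_eq)
    have QR: "Q = R (P $ k)"
      using Q(3) insert.hyps by (simp add: R_def Finite_Cartesian_Product.vec_eq_iff)
    have "det Q = det (R (re + \<i> *s im))"
      using QR unfolding Pk by simp
    also have "\<dots> = det (R re) + \<i> * det (R im)"
      using Determinants.det_row_add[of k "\<lambda>_. re" "\<lambda>_. \<i> *s im" "\<lambda>i. Q $ i"]
        Determinants.det_row_mul[of k \<i> "\<lambda>_. im" "\<lambda>i. Q $ i"] by (simp add: R_def)
    finally have "det (R re) \<noteq> 0 \<or> det (R im) \<noteq> 0"
      using Q(1) by auto
    then obtain r where r: "det (R r) \<noteq> 0" "real_row r (P $ k)"
      unfolding real_row_def re_def im_def by metis
    show ?case
    proof (intro exI conjI ballI allI impI)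
      show "det (R r) \<noteq> 0" by fact
      show "real_row (R r $ i) (P $ i)" if "i \<in> insert k S" for i
        using that r(2) Q(2) by (auto simp: R_def)
      show "R r $ i = P $ i" if "i \<notin> insert k S" for i
        using that Q(3) by (auto simp: R_def)
    qed
  qed
  from this[of UNIV] obtain Q where Q: "det Q \<noteq> 0" "\<And>i. real_row (Q $ i) (P $ i)"
    by auto
  define G :: "real ^ 'n ^ 'n" where "G = (\<chi> i j. Re (Q $ i $ j))"
  have Q_real: "Q $ i $ j = of_real (G $ i $ j)" for i j
    using Q(2)[of i] unfolding real_row_def G_def by auto
  have "Q = map_matrix of_real G"
    by (simp add: Finite_Cartesian_Product.vec_eq_iff map_matrix_def Q_real)
  then have "det G \<noteq> 0"
    using Q(1) det_map_matrix_of_real[of G] by auto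
  moreover have "\<bar>(G *v x) $ i\<bar> \<le> cmod ((P *v (\<chi> j. complex_of_real (x $ j))) $ i)" for x i
  proof -
    let ?w = "(P *v (\<chi> j. complex_of_real (x $ j))) $ i"
    have "(G *v x) $ i = Re ?w \<or> (G *v x) $ i = Im ?w"
      using Q(2)[of i] unfolding real_row_def
      by (auto simp: matrix_vector_mult_def G_def)
    then show ?thesis
      using abs_Re_le_cmod abs_Im_le_cmod by metis
  qed
  ultimately show ?thesis
    using that by blast
qed

text \<open>Solutions of a triangular linear recursion grow in coordinate \<open>i\<close> at most like \<open>(\<theta> L\<^sub>i)\<^sup>n\<close>: the lower
  coordinates drive coordinate \<open>i\<close> by a term of at most that order, and since \<open>\<theta> L\<^sub>i > L\<^sub>i\<close> a large multiple of
  \<open>(\<theta> L\<^sub>i)\<^sup>n\<close> dominates this inhomogeneity. The slack \<open>\<theta>\<close> absorbs the polynomial factors of Jordan blocks.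
  The constant depends on the recursion alone, not on the solution, which makes the bound uniform in the
  initial vector.\<close>

lemma triangular_recursion_growth:
  fixes L :: "'n::finite \<Rightarrow> real" and b :: "'n \<Rightarrow> 'n \<Rightarrow> real" and \<sigma> :: "'n \<Rightarrow> nat" and \<theta> :: real
  assumes L: "\<And>i. 0 < L i" "\<And>i j. \<sigma> j < \<sigma> i \<Longrightarrow> L j \<le> L i"
    and b: "\<And>i j. 0 \<le> b i j" and \<theta>: "1 < \<theta>"
  obtains C where "0 \<le> C"
    "\<And>a K i n. \<lbrakk>\<And>i n. 0 \<le> a i n; 0 \<le> K; \<And>i. a i 0 \<le> K;
        \<And>i n. a i (Suc n) \<le> L i * a i n + (\<Sum>j | \<sigma> j < \<sigma> i. b i j * a j n)\<rbrakk>
      \<Longrightarrow> a i n \<le> C * K * (\<theta> * L i) ^ n"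
proof -
  define H where "H = (\<lambda>a K. (\<forall>i n. 0 \<le> a i n) \<and> 0 \<le> K \<and> (\<forall>i. a i 0 \<le> K) \<and>
        (\<forall>i n. a i (Suc n) \<le> L i * a i n + (\<Sum>j | \<sigma> j < \<sigma> i. b i j * a j n)))"
  have "\<exists>C\<ge>0. \<forall>a K. H a K \<longrightarrow> (\<forall>n. a i n \<le> C * K * (\<theta> * L i) ^ n)" for i
  proof (induction i rule: measure_induct_rule[of \<sigma>])
    case (less i)
    then obtain C' where C': "\<And>j. \<sigma> j < \<sigma> i \<Longrightarrow> 0 \<le> C' j"
        "\<And>j a K n. \<sigma> j < \<sigma> i \<Longrightarrow> H a K \<Longrightarrow> a j n \<le> C' j * K * (\<theta> * L j) ^ n"
      by metis
    define D where "D = (\<Sum>j | \<sigma> j < \<sigma> i. b i j * C' j)"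
    \<comment> \<open>Chosen such that \<open>L i * Ci + D \<le> \<theta> * L i * Ci\<close> and \<open>1 \<le> Ci\<close>, as the induction step and its start
      require.\<close>
    define Ci where "Ci = 1 + D / ((\<theta> - 1) * L i)"
    have D0: "0 \<le> D"
      unfolding D_def by (intro sum_nonneg mult_nonneg_nonneg b) (use C' in auto)
    have Ci0: "1 \<le> Ci"
      unfolding Ci_def using D0 L(1)[of i] \<theta> by simp
    have "(\<theta> - 1) * L i * Ci = (\<theta> - 1) * L i + D"
      unfolding Ci_def using L(1)[of i] \<theta> by (simp add: field_simps)
    moreover have "0 < (\<theta> - 1) * L i"
      using L(1)[of i] \<theta> by simp
    ultimately have Ci: "L i * Ci + D \<le> Ci * (\<theta> * L i)"
      by (simp add: algebra_simps)
    have "a i n \<le> Ci * K * (\<theta> * L i) ^ n" if HaK: "H a K" for a K n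
    proof (induction n)
      case 0
      have "a i 0 \<le> 1 * K" and "0 \<le> K"
        using HaK by (auto simp: H_def)
      then show ?case
        using mult_right_mono[OF Ci0, of K] by simp
    next
      case (Suc n)
      have K: "0 \<le> K" using HaK by (simp add: H_def)
      have "a j n \<le> C' j * K * (\<theta> * L i) ^ n" if "\<sigma> j < \<sigma> i" for j
      proof -
        have "a j n \<le> C' j * K * (\<theta> * L j) ^ n"
          using C'(2)[OF that HaK] .
        also have "\<dots> \<le> C' j * K * (\<theta> * L i) ^ n"
          using C'(1)[OF that] K L(1)[of j] L(2)[OF that] \<theta>
          by (intro mult_left_mono power_mono mult_nonneg_nonneg) auto
        finally show ?thesis .
      qed
      then have "(\<Sum>j | \<sigma> j < \<sigma> i. b i j * a j n) \<le> (\<Sum>j | \<sigma> j < \<sigma> i. b i j * (C' j * K * (\<theta> * L i) ^ n))"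
        by (intro sum_mono mult_left_mono b) auto
      also have "\<dots> = D * K * (\<theta> * L i) ^ n"
        unfolding D_def by (simp add: sum_distrib_right mult.assoc)
      finally have "(\<Sum>j | \<sigma> j < \<sigma> i. b i j * a j n) \<le> D * K * (\<theta> * L i) ^ n" .
      moreover have "a i (Suc n) \<le> L i * a i n + (\<Sum>j | \<sigma> j < \<sigma> i. b i j * a j n)"
        using HaK by (simp add: H_def)
      ultimately have "a i (Suc n) \<le> L i * a i n + D * K * (\<theta> * L i) ^ n"
        by linarith
      also have "\<dots> \<le> L i * (Ci * K * (\<theta> * L i) ^ n) + D * K * (\<theta> * L i) ^ n"
        using Suc.IH L(1)[of i] by (intro add_right_mono mult_left_mono) auto
      also have "\<dots> = (L i * Ci + D) * (K * (\<theta> * L i) ^ n)"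
        by (simp add: algebra_simps)
      also have "\<dots> \<le> (Ci * (\<theta> * L i)) * (K * (\<theta> * L i) ^ n)"
        using Ci K L(1)[of i] \<theta> by (intro mult_right_mono) auto
      also have "\<dots> = Ci * K * (\<theta> * L i) ^ Suc n"
        by simp
      finally show ?case .
    qed
    then show ?case
      using Ci0 by (intro exI[of _ Ci]) auto
  qed
  then obtain C where C: "\<And>i. 0 \<le> C i" "\<And>i a K n. H a K \<Longrightarrow> a i n \<le> C i * K * (\<theta> * L i) ^ n"
    by metis
  show ?thesis
  proof (rule that[of "\<Sum>i\<in>UNIV. C i"])
    show "0 \<le> (\<Sum>i\<in>UNIV. C i)"
      by (intro sum_nonneg C)
    fix a K i n
    assume asm: "\<And>i n. 0 \<le> a i n" "0 \<le> K" "\<And>i. a i 0 \<le> K"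
        "\<And>i n. a i (Suc n) \<le> L i * a i n + (\<Sum>j | \<sigma> j < \<sigma> i. b i j * a j n)"
    then have "a i n \<le> C i * K * (\<theta> * L i) ^ n"
      by (intro C) (auto simp: H_def)
    also have "\<dots> \<le> (\<Sum>i\<in>UNIV. C i) * K * (\<theta> * L i) ^ n"
      using asm(2) L(1)[of i] \<theta> C(1) by (intro mult_right_mono member_le_sum) auto
    finally show "a i n \<le> (\<Sum>i\<in>UNIV. C i) * K * (\<theta> * L i) ^ n" .
  qed
qed

text \<open>Real linear coordinates in which the \<open>i\<close>-th component of \<open>A\<^sup>n x\<close> grows at most at the rate of a
  single eigenvalue, up to the factor \<open>\<theta>\<^sup>n\<close>; they confine the image of a ball to a box.\<close>

lemma adapted_coordinates:
  fixes A :: "int ^ 'n ^ 'n" and lam :: "nat \<Rightarrow> complex" and \<theta> :: real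
  assumes cp: "charpoly (map_matrix complex_of_int A) = (\<Prod>j\<in>{1..CARD('n)}. [:- lam j, 1:])"
    and nz: "\<And>j. j \<in> {1..CARD('n)} \<Longrightarrow> lam j \<noteq> 0"
    and mono: "\<And>i j. 1 \<le> i \<Longrightarrow> i \<le> j \<Longrightarrow> j \<le> CARD('n) \<Longrightarrow> cmod (lam i) \<le> cmod (lam j)"
    and \<theta>: "1 < \<theta>"
  obtains G :: "real ^ 'n ^ 'n" and \<sigma> :: "'n \<Rightarrow> nat" and C :: real
  where "det G \<noteq> 0" "bij_betw \<sigma> UNIV {1..CARD('n)}" "0 < C"
    "\<And>n x i. \<bar>(G *v ((\<lambda>x. map_matrix real_of_int A *v x) ^^ n) x) $ i\<bar>
        \<le> C * (\<theta> * cmod (lam (\<sigma> i))) ^ n * norm x"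
proof -
  obtain P B :: "complex ^ 'n ^ 'n" and \<sigma> :: "'n \<Rightarrow> nat"
    where \<sigma>: "bij_betw \<sigma> UNIV {1..CARD('n)}" and P: "det P \<noteq> 0"
      and PB: "P ** map_matrix complex_of_int A = B ** P"
      and B: "\<And>i. B $ i $ i = lam (\<sigma> i)" "\<And>i j. \<sigma> i < \<sigma> j \<Longrightarrow> B $ i $ j = 0"
    using schur_triangularization[OF cp] by metis
  obtain G :: "real ^ 'n ^ 'n" where G: "det G \<noteq> 0"
    "\<And>x i. \<bar>(G *v x) $ i\<bar> \<le> cmod ((P *v (\<chi> j. complex_of_real (x $ j))) $ i)"
    using nonsingular_real_rows[OF P] by metis
  define cv where "cv = (\<lambda>x :: real ^ 'n. \<chi> j. complex_of_real (x $ j))"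
  define AR where "AR = (map_matrix real_of_int A :: real ^ 'n ^ 'n)"
  have \<sigma>_in: "\<sigma> i \<in> {1..CARD('n)}" for i
    using \<sigma> by (auto simp: bij_betw_def)
  have \<sigma>_inj: "\<sigma> i = \<sigma> j \<longleftrightarrow> i = j" for i j
    using \<sigma> by (auto simp: bij_betw_def inj_on_def)
  have cvA: "cv (AR *v x) = map_matrix complex_of_int A *v cv x" for x
    by (simp add: cv_def AR_def matrix_vector_mult_def map_matrix_def Finite_Cartesian_Product.vec_eq_iff)
  define L where "L = (\<lambda>i. cmod (lam (\<sigma> i)))"
  obtain C where C: "0 \<le> C"
    "\<And>a K i n. \<lbrakk>\<And>i n. 0 \<le> a i n; 0 \<le> K; \<And>i. a i 0 \<le> K;
        \<And>i n. a i (Suc n) \<le> L i * a i n + (\<Sum>j | \<sigma> j < \<sigma> i. cmod (B $ i $ j) * a j n)\<rbrakk>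
      \<Longrightarrow> a i n \<le> C * K * (\<theta> * L i) ^ n"
  proof (rule triangular_recursion_growth[of L \<sigma> "\<lambda>i j. cmod (B $ i $ j)" \<theta>])
    show "0 < L i" for i
      using nz[OF \<sigma>_in] by (simp add: L_def)
    show "L j \<le> L i" if "\<sigma> j < \<sigma> i" for i j
      unfolding L_def using that \<sigma>_in[of i] \<sigma>_in[of j] by (intro mono) auto
  qed (use \<theta> in auto)
  define K where "K = (\<Sum>i\<in>UNIV. \<Sum>j\<in>UNIV. cmod (P $ i $ j))"
  have K0: "0 \<le> K"
    unfolding K_def by (intro sum_nonneg) auto
  have bound: "cmod ((P *v cv (((*v) AR ^^ n) x)) $ i) \<le> C * (K * norm x) * (\<theta> * L i) ^ n" for n x i
  proof (rule C(2)[of "\<lambda>i n. cmod ((P *v cv (((*v) AR ^^ n) x)) $ i)"])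
    show "0 \<le> K * norm x"
      using K0 by simp
    show "cmod ((P *v cv (((*v) AR ^^ 0) x)) $ i) \<le> K * norm x" for i
    proof -
      have "cmod ((P *v cv x) $ i) \<le> (\<Sum>j\<in>UNIV. cmod (P $ i $ j) * \<bar>x $ j\<bar>)"
        unfolding matrix_vector_mult_def cv_def by (simp add: sum_norm_le norm_mult)
      also have "\<dots> \<le> (\<Sum>j\<in>UNIV. cmod (P $ i $ j) * norm x)"
        by (intro sum_mono mult_left_mono component_le_norm_cart) auto
      also have "\<dots> = (\<Sum>j\<in>UNIV. cmod (P $ i $ j)) * norm x"
        by (simp add: sum_distrib_right)
      also have "\<dots> \<le> K * norm x"
        unfolding K_def by (intro mult_right_mono member_le_sum[of i UNIV "\<lambda>i. \<Sum>j\<in>UNIV. cmod (P $ i $ j)"] sum_nonneg) auto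
      finally show ?thesis by simp
    qed
    fix i n
    let ?y = "P *v cv (((*v) AR ^^ n) x)"
    have "P *v cv (((*v) AR ^^ Suc n) x) = B *v ?y"
      by (simp add: cvA matrix_vector_mul_assoc PB)
    moreover have "(B *v ?y) $ i = lam (\<sigma> i) * ?y $ i + (\<Sum>j | \<sigma> j < \<sigma> i. B $ i $ j * ?y $ j)"
    proof -
      have "(B *v ?y) $ i = (\<Sum>j\<in>insert i {j. \<sigma> j < \<sigma> i}. B $ i $ j * ?y $ j)"
        unfolding matrix_vector_mult_def vec_lambda_beta
        by (rule sum.mono_neutral_right) (use B(2) \<sigma>_inj in \<open>auto simp: not_less_iff_gr_or_eq\<close>)
      then show ?thesis
        by (simp add: B(1))
    qed
    moreover have "cmod \<dots> \<le> L i * cmod (?y $ i) + (\<Sum>j | \<sigma> j < \<sigma> i. cmod (B $ i $ j) * cmod (?y $ j))"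
      unfolding L_def by (intro norm_triangle_mono sum_norm_le) (auto simp: norm_mult)
    ultimately show "cmod ((P *v cv (((*v) AR ^^ Suc n) x)) $ i)
        \<le> L i * cmod (?y $ i) + (\<Sum>j | \<sigma> j < \<sigma> i. cmod (B $ i $ j) * cmod (?y $ j))"
      by simp
  qed simp
  show ?thesis
  proof (rule that[OF G(1) \<sigma>, of "C * K + 1"])
    show "0 < C * K + 1"
      using C(1) K0 by (simp add: add_nonneg_pos)
    fix n x i
    have "\<bar>(G *v ((*v) AR ^^ n) x) $ i\<bar> \<le> C * (K * norm x) * (\<theta> * L i) ^ n"
      using G(2) bound unfolding cv_def by (rule order_trans)
    also have "\<dots> \<le> (C * K + 1) * (\<theta> * L i) ^ n * norm x"
      using \<theta> by (simp add: algebra_simps L_def)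
    finally show "\<bar>(G *v ((\<lambda>x. map_matrix real_of_int A *v x) ^^ n) x) $ i\<bar>
        \<le> (C * K + 1) * (\<theta> * cmod (lam (\<sigma> i))) ^ n * norm x"
      by (simp add: AR_def L_def)
  qed
qed

section \<open>Covers of the target set\<close>

text \<open>For a cube of side about \<open>exp (- n (\<tau> + l k))\<close> and a ball of radius \<open>r = exp (- n \<tau>)\<close>, the sum of the ball
  and the image of the cube has width about \<open>r * max 1 (exp (n (l j - l k)))\<close> in the direction of the \<open>j\<close>-th
  eigenvalue. Only \<open>j > k\<close> contributes more than \<open>r\<close>, so its volume is about \<open>r\<^sup>d exp (n \<Sum>\<^sub>j\<^sub>>\<^sub>k (l j - l k))\<close>.
  Multiplying by the number \<open>exp (n d (\<tau> + l k))\<close> of cubes in the grid gives the bound.\<close>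

lemma meeting_cubes_growth:
  fixes A :: "int ^ 'n ^ 'n" and G :: "real ^ 'n ^ 'n" and \<sigma> :: "'n \<Rightarrow> nat" and l :: "nat \<Rightarrow> real"
  defines "d \<equiv> CARD('n)"
  assumes A: "det (map_matrix real_of_int A) \<noteq> 0"
    and G: "det G \<noteq> 0" and \<sigma>: "bij_betw \<sigma> UNIV {1..d}" and C: "0 < C" and \<epsilon>: "0 < \<epsilon>"
    and growth: "\<And>n x i. \<bar>(G *v ((*v) (map_matrix real_of_int A) ^^ n) x) $ i\<bar>
        \<le> C * exp (\<epsilon> + l (\<sigma> i)) ^ n * norm x"
    and mono: "\<And>i j. 1 \<le> i \<Longrightarrow> i \<le> j \<Longrightarrow> j \<le> d \<Longrightarrow> l i \<le> l j"
    and k: "k \<in> {1..d}" and \<tau>: "0 < \<tau> + l k"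
  obtains B where "0 < B"
    "\<And>n y0. real (card (meeting_cubes ((*v) (map_matrix real_of_int A) ^^ n) y0 (exp (- (real n * \<tau>)))
        (nat \<lceil>exp (real n * (\<tau> + l k))\<rceil>)))
      \<le> B * exp (real n * (real k * l k + (\<Sum>j\<in>{k<..d}. l j) + real d * \<epsilon>))"
proof -
  let ?A = "map_matrix real_of_int A :: real ^ 'n ^ 'n"
  define q where "q n = nat \<lceil>exp (real n * (\<tau> + l k))\<rceil>" for n
  define r where "r n = exp (- (real n * \<tau>))" for n
  have q: "0 < q n" "exp (real n * (\<tau> + l k)) \<le> q n" "q n \<le> 2 * exp (real n * (\<tau> + l k))" for n
  proof -
    have "1 \<le> exp (real n * (\<tau> + l k))"
      using \<tau> by simp
    then show "0 < q n" "exp (real n * (\<tau> + l k)) \<le> q n" "q n \<le> 2 * exp (real n * (\<tau> + l k))"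
      unfolding q_def by linarith+
  qed
  obtain CG where CG: "0 < CG" "\<And>x. norm (G *v x) \<le> CG * norm x"
    using linear_bounded_pos[OF matrix_vector_mul_linear[of G]] by metis
  obtain \<Delta> where \<Delta>: "0 < \<Delta>"
    "\<forall>b. (\<forall>i. 0 \<le> b i) \<longrightarrow> {y. \<forall>i. \<bar>(G *v y) $ i\<bar> \<le> b i} \<in> lmeasurable \<and>
       measure lebesgue {y. \<forall>i. \<bar>(G *v y) $ i\<bar> \<le> b i} = \<Delta> * (\<Prod>i\<in>UNIV. 2 * b i)"
    using measure_linear_slab_box[OF G] by blast
  define C2 where "C2 = CG + C * d"
  have C2: "0 < C2" unfolding C2_def using CG(1) C by (simp add: add_pos_nonneg)
  \<comment> \<open>Half the width of \<open>K\<close> in direction \<open>i\<close>.\<close>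
  define b where "b n i = C2 * r n * exp (n * \<epsilon>) * exp (real n * max 0 (l (\<sigma> i) - l k))" for n i
  have b0: "0 \<le> b n i" for n i
    unfolding b_def r_def using C2 by simp
  have K: "{y. \<forall>i. \<bar>(G *v y) $ i\<bar> \<le> b n i} \<in> lmeasurable"
    "measure lebesgue {y. \<forall>i. \<bar>(G *v y) $ i\<bar> \<le> b n i} = \<Delta> * (\<Prod>i\<in>UNIV. 2 * b n i)" for n
    using \<Delta>(2)[rule_format, of "b n"] b0 by auto
  have inK: "\<bar>(G *v (u + (((*v) ?A) ^^ n) w)) $ i\<bar> \<le> b n i"
    if u: "norm u < r n" and w: "\<And>i. \<bar>w $ i\<bar> \<le> 1 / real (q n)" for n u w i
  proof -
    have "\<bar>(G *v u) $ i\<bar> \<le> CG * r n"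
      using component_le_norm_cart[of "G *v u" i] CG(2)[of u] mult_left_mono[OF less_imp_le[OF u], of CG] CG(1)
      by linarith
    also have "\<dots> = CG * r n * 1 * 1" by simp
    also have "\<dots> \<le> CG * r n * exp (n * \<epsilon>) * exp (real n * max 0 (l (\<sigma> i) - l k))"
      using CG(1) \<epsilon> by (intro mult_mono) (auto simp: r_def)
    finally have 1: "\<bar>(G *v u) $ i\<bar> \<le> CG * r n * exp (n * \<epsilon>) * exp (real n * max 0 (l (\<sigma> i) - l k))" .
    have "norm w \<le> (\<Sum>i\<in>UNIV. \<bar>w $ i\<bar>)" by (rule norm_le_l1_cart)
    also have "\<dots> \<le> (\<Sum>i\<in>(UNIV::'n set). 1 / real (q n))" by (intro sum_mono w)
    also have "\<dots> = d * (1 / q n)" by (simp add: d_def)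
    also have "\<dots> \<le> d * (1 / exp (real n * (\<tau> + l k)))"
      using q[of n] by (intro mult_left_mono divide_left_mono) auto
    finally have nw: "norm w \<le> d * exp (- (real n * (\<tau> + l k)))"
      by (simp add: exp_minus divide_inverse)
    have "\<bar>(G *v (((*v) ?A) ^^ n) w) $ i\<bar> \<le> C * exp (\<epsilon> + l (\<sigma> i)) ^ n * norm w"
      by (rule growth)
    also have "\<dots> \<le> C * exp (\<epsilon> + l (\<sigma> i)) ^ n * (d * exp (- (real n * (\<tau> + l k))))"
      using C by (intro mult_left_mono nw) auto
    also have "\<dots> = C * d * r n * exp (n * \<epsilon>) * exp (real n * (l (\<sigma> i) - l k))"
      by (simp add: r_def algebra_simps flip: exp_of_nat_mult exp_add)
    also have "\<dots> \<le> C * d * r n * exp (n * \<epsilon>) * exp (real n * max 0 (l (\<sigma> i) - l k))"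
      using C by (intro mult_left_mono) (auto simp: r_def intro!: mult_left_mono)
    finally have "\<bar>(G *v (((*v) ?A) ^^ n) w) $ i\<bar> \<le> C * d * r n * exp (n * \<epsilon>) * exp (real n * max 0 (l (\<sigma> i) - l k))" .
    with 1 have "\<bar>(G *v u) $ i\<bar> + \<bar>(G *v (((*v) ?A) ^^ n) w) $ i\<bar> \<le> b n i"
      by (simp add: b_def C2_def algebra_simps)
    then show ?thesis
      by (simp add: matrix_vector_right_distrib)
  qed
  have prod_b: "(\<Prod>i\<in>UNIV. 2 * b n i) = (2 * C2) ^ d * exp (real n * (d * \<epsilon> - d * \<tau> + (\<Sum>j\<in>{k<..d}. l j - l k)))" for n
  proof -
    have "(\<Sum>i\<in>UNIV. max 0 (l (\<sigma> i) - l k)) = (\<Sum>j\<in>{1..d}. max 0 (l j - l k))"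
      by (rule sum.reindex_bij_betw[OF \<sigma>])
    also have "\<dots> = (\<Sum>j\<in>{k<..d}. max 0 (l j - l k))"
      using k mono by (intro sum.mono_neutral_right) auto
    also have "\<dots> = (\<Sum>j\<in>{k<..d}. l j - l k)"
      using k mono by (intro sum.cong) auto
    finally have s: "(\<Sum>i\<in>UNIV. max 0 (l (\<sigma> i) - l k)) = (\<Sum>j\<in>{k<..d}. l j - l k)" .
    have "2 * b n i = (2 * C2) * exp (real n * (\<epsilon> - \<tau> + max 0 (l (\<sigma> i) - l k)))" for i
      by (simp add: b_def r_def algebra_simps flip: exp_add)
    then have "(\<Prod>i\<in>UNIV. 2 * b n i) = (2 * C2) ^ d * exp (\<Sum>i\<in>(UNIV::'n set). real n * (\<epsilon> - \<tau> + max 0 (l (\<sigma> i) - l k)))"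
      by (simp add: prod.distrib exp_sum d_def)
    also have "(\<Sum>i\<in>(UNIV::'n set). real n * (\<epsilon> - \<tau> + max 0 (l (\<sigma> i) - l k)))
        = real n * (d * \<epsilon> - d * \<tau> + (\<Sum>j\<in>{k<..d}. l j - l k))"
      unfolding sum_distrib_left[symmetric] sum.distrib s by (simp add: d_def algebra_simps)
    finally show ?thesis .
  qed
  have exponent: "d * (\<tau> + l k) + (d * \<epsilon> - d * \<tau> + (\<Sum>j\<in>{k<..d}. l j - l k))
      = real k * l k + (\<Sum>j\<in>{k<..d}. l j) + real d * \<epsilon>"
    using k by (simp add: sum_subtractf of_nat_diff algebra_simps)
  have lin: "linear (((*v) ?A) ^^ n)" for n
    by (intro funpow_linear matrix_vector_mul_linear)
  have "inj ((*v) ?A)"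
    using A unfolding invertible_det_nz[symmetric] invertible_left_inverse matrix_left_invertible_injective .
  then have inj: "inj (((*v) ?A) ^^ n)" for n
    by (rule inj_fn)
  have latt: "(((*v) ?A) ^^ n) x \<in> int_lattice" if "x \<in> int_lattice" for n x
    using that by (induction n) (auto intro: int_lattice_matrix_mult)
  show ?thesis
  proof (rule that[of "4 ^ d * \<Delta> * (2 * C2) ^ d"])
    show "0 < 4 ^ d * \<Delta> * (2 * C2) ^ d"
      using \<Delta>(1) C2 by simp
    fix n y0
    have "real (card (meeting_cubes (((*v) ?A) ^^ n) y0 (r n) (q n)))
        \<le> (2 * real (q n)) ^ d * measure lebesgue {y. \<forall>i. \<bar>(G *v y) $ i\<bar> \<le> b n i}"
      unfolding d_def
      by (rule card_meeting_cubes_le[OF lin inj latt q(1) K(1)]) (use inK in auto)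
    also have "\<dots> = (2 * real (q n)) ^ d * (\<Delta> * (\<Prod>i\<in>UNIV. 2 * b n i))"
      by (subst K(2)) simp
    also have "\<dots> \<le> (4 * exp (real n * (\<tau> + l k))) ^ d * (\<Delta> * (\<Prod>i\<in>UNIV. 2 * b n i))"
      using q(3)[of n] \<Delta>(1) b0 by (intro mult_right_mono power_mono mult_nonneg_nonneg prod_nonneg) auto
    also have "\<dots> = 4 ^ d * \<Delta> * (2 * C2) ^ d * exp (real n * (d * (\<tau> + l k) + (d * \<epsilon> - d * \<tau> + (\<Sum>j\<in>{k<..d}. l j - l k))))"
      unfolding prod_b by (simp add: power_mult_distrib algebra_simps flip: exp_of_nat_mult exp_add)
    also have "\<dots> = 4 ^ d * \<Delta> * (2 * C2) ^ d * exp (real n * (real k * l k + (\<Sum>j\<in>{k<..d}. l j) + real d * \<epsilon>))"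
      unfolding exponent ..
    finally show "real (card (meeting_cubes (((*v) ?A) ^^ n) y0 (exp (- (real n * \<tau>))) (nat \<lceil>exp (real n * (\<tau> + l k))\<rceil>)))
        \<le> 4 ^ d * \<Delta> * (2 * C2) ^ d * exp (real n * (real k * l k + (\<Sum>j\<in>{k<..d}. l j) + real d * \<epsilon>))"
      unfolding r_def q_def .
  qed
qed

text \<open>At level \<open>n\<close> the target set is covered by about \<open>exp (n \<gamma>)\<close> cubes of diameter about \<open>exp (- n \<kappa>)\<close>, so the
  sum of the \<open>s\<close>-th powers of all diameters is a convergent geometric series if \<open>\<gamma> < s \<kappa>\<close>.\<close>

lemma hausdorff_measure_shrinking_target_eq_0:
  fixes A :: "int ^ 'n ^ 'n" and l :: "nat \<Rightarrow> real" and z :: "nat \<Rightarrow> 'n torus"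
  assumes growth: "\<And>n y0. real (card (meeting_cubes ((*v) (map_matrix real_of_int A) ^^ n) y0 (exp (- (real n * \<tau>)))
        (nat \<lceil>exp (real n * \<kappa>)\<rceil>))) \<le> B * exp (real n * \<gamma>)"
    and \<kappa>: "0 < \<kappa>" and s: "0 < s" "\<gamma> < s * \<kappa>"
  shows "hausdorff_measure s (shrinking_target_set A z \<tau>) = 0"
proof -
  let ?A = "map_matrix real_of_int A :: real ^ 'n ^ 'n" and ?d = "real CARD('n)"
  define q where "q n = nat \<lceil>exp (real n * \<kappa>)\<rceil>" for n
  have q: "0 < q n" "exp (real n * \<kappa>) \<le> q n" for n
  proof -
    have "1 \<le> exp (real n * \<kappa>)"
      using \<kappa> by simp
    then show "0 < q n" "exp (real n * \<kappa>) \<le> q n"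
      unfolding q_def by linarith+
  qed
  have "\<exists>y. z n = abs_torus y" for n
    using torus_representative by metis
  then obtain y where y: "\<And>n. z n = abs_torus (y n)"
    by metis
  define M where "M n = meeting_cubes (((*v) ?A) ^^ n) (y n) (exp (- (real n * \<tau>))) (q n)" for n
  define F where "F n = (\<lambda>c. abs_torus ` grid_cube (q n) c) ` M n" for n
  define \<delta> where "\<delta> n = ?d * exp (- \<kappa>) ^ n" for n
  have finM: "finite (M n)" for n
    unfolding M_def by (rule finite_meeting_cubes)
  have \<delta>_eq: "\<delta> n = ?d * exp (- (real n * \<kappa>))" for n
    unfolding \<delta>_def by (simp flip: exp_of_nat_mult)
  show ?thesis
  proof (rule hausdorff_measure_limsup_eq_0[OF s(1), of F _ \<delta>])
    show "finite (F n)" for n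
      unfolding F_def using finM by simp
    show "\<exists>\<^sub>\<infinity>n. x \<in> \<Union>(F n)" if "x \<in> shrinking_target_set A z \<tau>" for x
    proof -
      have "\<exists>\<^sub>\<infinity>n. dist (abs_torus (y n)) ((torus_map A ^^ n) x) < exp (- (real n * \<tau>))"
        using that by (simp add: shrinking_target_set_def y)
      then show ?thesis
      proof (rule frequently_elim1)
        fix n assume "dist (abs_torus (y n)) ((torus_map A ^^ n) x) < exp (- (real n * \<tau>))"
        from meeting_cubes_cover[OF q(1) this] show "x \<in> \<Union>(F n)"
          unfolding F_def M_def by simp
      qed
    qed
    show "bounded U \<and> diameter U \<le> \<delta> n" if U: "U \<in> F n" for n U
    proof -
      obtain c where c: "U = abs_torus ` grid_cube (q n) c"
        using U by (auto simp: F_def)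
      have "?d / q n \<le> ?d / exp (real n * \<kappa>)"
        using q[of n] by (intro divide_left_mono) auto
      then have le: "?d / q n \<le> \<delta> n"
        by (simp add: \<delta>_eq exp_minus divide_inverse)
      have *: "dist u v \<le> \<delta> n" if uv: "u \<in> U" "v \<in> U" for u v
      proof -
        obtain a b where ab: "u = abs_torus a" "v = abs_torus b" "a \<in> grid_cube (q n) c" "b \<in> grid_cube (q n) c"
          using uv c by auto
        show ?thesis
          unfolding ab(1,2) using dist_abs_torus_le[of a b] grid_cube_norm_le[OF ab(3,4) q(1)] le by linarith
      qed
      have "bounded U"
        unfolding bounded_two_points using * by blast
      moreover have "diameter U \<le> \<delta> n"
        unfolding diameter_def using * by (auto simp: \<delta>_def intro!: cSUP_least)
      ultimately show ?thesis by blast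
    qed
    show "\<delta> \<longlonglongrightarrow> 0"
      unfolding \<delta>_def using \<kappa> by (intro tendsto_mult_right_zero LIMSEQ_power_zero) auto
    have bound: "real (card (F n)) * \<delta> n powr s \<le> B * ?d powr s * exp (\<gamma> - s * \<kappa>) ^ n" for n
    proof -
      have "real (card (F n)) \<le> real (card (M n))"
        unfolding F_def using card_image_le[OF finM] by simp
      also have "\<dots> \<le> B * exp (real n * \<gamma>)"
        unfolding M_def q_def by (rule growth)
      finally have "real (card (F n)) * \<delta> n powr s \<le> (B * exp (real n * \<gamma>)) * \<delta> n powr s"
        by (rule mult_right_mono) simp
      also have "\<dots> = B * ?d powr s * exp (\<gamma> - s * \<kappa>) ^ n"
        unfolding \<delta>_eq
        by (simp add: powr_mult exp_powr_real algebra_simps flip: exp_of_nat_mult exp_add)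
      finally show ?thesis .
    qed
    have "summable (\<lambda>n. B * ?d powr s * exp (\<gamma> - s * \<kappa>) ^ n)"
      using s(2) by (intro summable_mult summable_geometric) simp
    then show "summable (\<lambda>n. real (card (F n)) * \<delta> n powr s)"
      by (rule summable_comparison_test'[where N = 0]) (use bound in auto)
  qed
qed

section \<open>The dimension bound\<close>

theorem theorem2p3:
  fixes A :: "int ^ 'n ^ 'n"
    and lam :: "nat \<Rightarrow> complex"
    and l :: "nat \<Rightarrow> real"
    and z :: "nat \<Rightarrow> 'n torus"
    and \<tau> :: real
  assumes "invertible (map_matrix real_of_int A)"
    and "charpoly (map_matrix complex_of_int A) = (\<Prod>j\<in>{1..CARD('n)}. [:- lam j, 1:])"
    and "0 < cmod (lam 1)"
    and "\<And>i j. 1 \<le> i \<Longrightarrow> i \<le> j \<Longrightarrow> j \<le> CARD('n) \<Longrightarrow> cmod (lam i) \<le> cmod (lam j)"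
    and "\<And>j. j \<in> {1..CARD('n)} \<Longrightarrow> l j = ln (cmod (lam j))"
    and "\<tau> \<ge> 0"
  shows "hausdorff_dim (shrinking_target_set A z \<tau>) \<le>
    (INF k\<in>{k\<in>{1..CARD('n)}. \<tau> + l k > 0}.
       ereal ((real k * l k + (\<Sum>j\<in>{k<..CARD('n)}. l j)) / (\<tau> + l k)))"
proof (rule INF_greatest)
  let ?d = "CARD('n)"
  note cp = assms(2) and mono = assms(4)
  fix k assume "k \<in> {k \<in> {1..?d}. \<tau> + l k > 0}"
  then have k: "k \<in> {1..?d}" and \<kappa>: "0 < \<tau> + l k"
    by auto
  define S where "S = real k * l k + (\<Sum>j\<in>{k<..?d}. l j)"
  have lam_pos: "0 < cmod (lam j)" if "j \<in> {1..?d}" for j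
    using mono[of 1 j] assms(3) that by auto
  have exp_l: "exp (l j) = cmod (lam j)" if "j \<in> {1..?d}" for j
    using assms(5)[OF that] lam_pos[OF that] by simp
  have l_mono: "l i \<le> l j" if "1 \<le> i" "i \<le> j" "j \<le> ?d" for i j
  proof -
    have "exp (l i) \<le> exp (l j)"
      using mono[OF that] that by (simp add: exp_l del: exp_le_cancel_iff)
    then show ?thesis by simp
  qed
  have det_A: "det (map_matrix real_of_int A) \<noteq> 0"
    using assms(1) by (simp add: invertible_det_nz)
  \<comment> \<open>The exponent must be nonnegative to be admissible for a dimension. It is because \<open>S\<close> dominates
    the sum of all \<open>l j\<close>, the logarithm of the absolute value of a nonzero integer determinant.\<close>
  have "0 \<le> S"
  proof -
    have "det A \<noteq> 0"
      using det_A det_map_matrix_of_int[of A, where 'a = real] by auto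
    then have "1 \<le> \<bar>det A\<bar>"
      by linarith
    then have "1 \<le> cmod (of_int (det A))"
      unfolding norm_of_int by linarith
    also have "of_int (det A) = (\<Prod>j\<in>{1..?d}. lam j)"
    proof -
      have "det (map_matrix complex_of_int A) = (\<Prod>j\<in>{1..?d}. lam j)"
        by (rule schur_triangularization[OF cp])
      then show ?thesis
        by (simp only: det_map_matrix_of_int)
    qed
    also have "cmod (\<Prod>j\<in>{1..?d}. lam j) = (\<Prod>j\<in>{1..?d}. cmod (lam j))"
      by (rule prod_norm[symmetric])
    also have "\<dots> = exp (\<Sum>j\<in>{1..?d}. l j)"
      by (simp add: exp_sum exp_l)
    finally have "0 \<le> (\<Sum>j\<in>{1..?d}. l j)"
      by simp
    also have "(\<Sum>j\<in>{1..?d}. l j) = (\<Sum>j\<in>{1..k}. l j) + (\<Sum>j\<in>{k<..?d}. l j)"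
      using k by (subst sum.union_disjoint[symmetric]) (auto intro!: sum.cong)
    also have "(\<Sum>j\<in>{1..k}. l j) \<le> (\<Sum>j\<in>{1..k}. l k)"
      using k by (intro sum_mono l_mono) auto
    finally show ?thesis
      by (simp add: S_def)
  qed
  have "hausdorff_dim (shrinking_target_set A z \<tau>) \<le> ereal (S / (\<tau> + l k)) + ereal e" if "0 < e" for e :: real
  proof -
    define s where "s = S / (\<tau> + l k) + e"
    have "s * (\<tau> + l k) = S + e * (\<tau> + l k)"
      using \<kappa> by (simp add: s_def distrib_right)
    then have s: "0 < s" "S < s * (\<tau> + l k)"
      using \<open>0 \<le> S\<close> \<kappa> \<open>0 < e\<close> by (auto simp: s_def intro!: add_nonneg_pos divide_nonneg_pos)
    \<comment> \<open>Half of the room between \<open>S\<close> and \<open>s * (\<tau> + l k)\<close> pays for the loss \<open>exp (n * d * \<epsilon>)\<close> in the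
      number of cubes.\<close>
    define room where "room = s * (\<tau> + l k) - S"
    have "0 < room"
      using s(2) by (simp add: room_def)
    define \<epsilon> where "\<epsilon> = room / (2 * ?d)"
    have "S + ?d * \<epsilon> = S + room / 2"
      by (simp add: \<epsilon>_def)
    also have "\<dots> < S + room"
      using \<open>0 < room\<close> by simp
    also have "\<dots> = s * (\<tau> + l k)"
      by (simp add: room_def)
    finally have \<epsilon>_small: "S + ?d * \<epsilon> < s * (\<tau> + l k)" .
    have \<epsilon>_pos: "0 < \<epsilon>"
      using \<open>0 < room\<close> by (simp add: \<epsilon>_def)
    have "hausdorff_measure s (shrinking_target_set A z \<tau>) = 0"
    proof (rule adapted_coordinates[OF cp _ mono, where \<theta> = "exp \<epsilon>"])
      show "lam j \<noteq> 0" if "j \<in> {1..?d}" for j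
        using lam_pos[OF that] by simp
      show "1 < exp \<epsilon>"
        using \<epsilon>_pos by simp
      fix G :: "real ^ 'n ^ 'n" and \<sigma> C
      assume G: "det G \<noteq> 0" and \<sigma>: "bij_betw \<sigma> UNIV {1..?d}" and C: "0 < C"
        and growth: "\<And>n x i. \<bar>(G *v ((\<lambda>x. map_matrix real_of_int A *v x) ^^ n) x) $ i\<bar>
          \<le> C * (exp \<epsilon> * cmod (lam (\<sigma> i))) ^ n * norm x"
      have "exp \<epsilon> * cmod (lam (\<sigma> i)) = exp (\<epsilon> + l (\<sigma> i))" for i
        using bij_betwE[OF \<sigma>] by (simp add: exp_add exp_l)
      then have "\<bar>(G *v ((*v) (map_matrix real_of_int A) ^^ n) x) $ i\<bar>
          \<le> C * exp (\<epsilon> + l (\<sigma> i)) ^ n * norm x" for n x i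
        using growth[of n x i] by (simp only:)
      note cubes = meeting_cubes_growth[OF det_A G \<sigma> C \<epsilon>_pos this _ k \<kappa>, folded S_def]
      show "hausdorff_measure s (shrinking_target_set A z \<tau>) = 0"
      proof (rule cubes)
        show "l i \<le> l j" if "1 \<le> i" "i \<le> j" "j \<le> ?d" for i j
          by (rule l_mono[OF that])
        fix B
        assume "\<And>n y0. real (card (meeting_cubes ((*v) (map_matrix real_of_int A) ^^ n) y0
              (exp (- (real n * \<tau>))) (nat \<lceil>exp (real n * (\<tau> + l k))\<rceil>)))
            \<le> B * exp (real n * (S + ?d * \<epsilon>))"
        then show "hausdorff_measure s (shrinking_target_set A z \<tau>) = 0"
          by (rule hausdorff_measure_shrinking_target_eq_0[OF _ \<kappa> s(1) \<epsilon>_small])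
      qed
    qed
    then have "s \<in> {s. 0 \<le> s \<and> hausdorff_measure s (shrinking_target_set A z \<tau>) = 0}"
      using s(1) by simp
    then have "hausdorff_dim (shrinking_target_set A z \<tau>) \<le> ereal s"
      unfolding hausdorff_dim_def by (rule INF_lower)
    then show ?thesis
      by (simp only: s_def plus_ereal.simps)
  qed
  then have "hausdorff_dim (shrinking_target_set A z \<tau>) \<le> ereal (S / (\<tau> + l k))"
    by (rule ereal_le_epsilon2)
  then show "hausdorff_dim (shrinking_target_set A z \<tau>) \<le> ereal ((real k * l k + (\<Sum>j\<in>{k<..?d}. l j)) / (\<tau> + l k))"
    by (simp add: S_def)
qed

end
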